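(* Let $\sigma$ and $\tau$ be types of an integer $n\ge 0$. The coefficient of $e^\otimes_\tau$ in the $e^\otimes$-expansion of $E_\sigma$ is $$(-1)^{\mathrm{area}(\tau)}\sum_T \mathrm{psgn}(T),$$ where the sum is over all bounded polywrapping block tabloids $T$ of shape $\sigma$ and content $\tau$.
   Context: **Types.** A composition is a finite (possibly empty) list $\beta$ of positive integers, with $\mathrm{area}(\beta)$ the sum of its entries and $\ell(\beta)$ its length. A partition is a weakly decreasing composition; $\mathrm{sort}(\beta)$ is the partition obtained by sorting $\beta$. An ordered type of $n$ is a sequence $\delta=(\delta|_1,\delta|_2,\ldots)$ of compositions with $\sum_i i\,\mathrm{area}(\delta|_i)=n$, written $\delta=1^{\delta|_1}2^{\delta|_2}\cdots$; $\mathrm{area}(\delta)=\sum_i\mathrm{area}(\delta|_i)$. A type is an ordered type with all $\delta|_i$ partitions, and $\mathrm{psort}(\delta)$ is the type obtained by replacing each $\delta|_i$ by $\mathrm{sort}(\delta|_i)$. A block $d^r$ ($d,r\ge1$) is the ordered type with $\delta|_d=(r)$ and all other $\delta|_i$ empty. A type $\tau$ is identified with the multiset of its blocks (one copy of $d^r$ for each part $r$ of $\tau|_d$), and we list its blocks as $d_1^{r_1}\cdots d_k^{r_k}$. An $r$-ordered type is an ordered type $\delta$ with $\mathrm{area}(\delta|_i)$ divisible by $r$ for all $i$; $\mathrm{OTyp}_r(n)$ is the set of $r$-ordered types of $n$. **Polysymmetric functions.** Let $x_{ij}$ ($i,j\ge1$) be commuting indeterminates with $\deg x_{ij}=i$.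 $\mathrm{PSym}$ is the $\mathbb{Q}$-algebra of bounded-degree formal power series in the $x_{ij}$ invariant under swapping $x_{ij}$ and $x_{ik}$ for all $i,j,k$; $\mathrm{PSym}(n)$ is its degree $n$ part. For an ordered type $\delta$, $e^\otimes_\delta=\prod_i e_{\delta|_i}(x_{i1},x_{i2},\ldots)$ where $e_\beta=\prod_j e_{\beta_j}$; $\{e^\otimes_\tau\}$ over types $\tau$ of $n$ is a basis of $\mathrm{PSym}(n)$, and the $e^\otimes$-expansion is the expansion in this basis. $E_d$ is the sum of $(-1)^{\mathrm{len}(f)}f$ over all square-free monomials $f$ of degree $d$ in the $x_{ij}$, where $\mathrm{len}(f)$ is the number of variables in $f$; $E_{d^r}$ is obtained from $E_d$ by replacing each $x_{ij}$ by $x_{ij}^r$; $E_\sigma=\prod_{i=1}^kE_{d_i^{r_i}}$ for $\sigma=d_1^{r_1}\cdots d_k^{r_k}$. **The function $\hat{s}_r$.** For an $r$-tuple $w=(w_0,\ldots,w_{r-1})$ of non-negative integers, let $v_i$ be the remainder of $w_i+i$ upon division by $r$; $\hat{s}_r(w)=(-1)^{\#\{i<j:\,v_i>v_j\}}$ if the $v_i$ are distinct, and $0$ otherwise. For a composition $\beta$ with $\ell(\beta)\le r$, $\hat{s}_r(\beta)=\sum_w\hat{s}_r(w)$ over all $r$-tuples $w$ of non-negative integers that become $\beta$ on deleting zeros; if $\ell(\beta)>r$, $\hat{s}_r(\beta)=0$. For an ordered type $\delta$, $\hat{s}_r(\delta)=\prod_i\hat{s}_r(\delta|_i)$. **Wrappings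 and polywrappings.** View the block $d^r$ as an array of boxes with $d$ rows and $r$ columns. For $k\mid d$, divide the rows from top to bottom into $d/k$ "$k$-sheets" of $k$ consecutive rows; list the $dr/k$ columns of $k$-sheets in reading order (first sheet left to right, then second sheet left to right, etc.). For a composition $\beta=(\beta_1,\ldots,\beta_l)$ of $dr/k$, the $k$-wrapping of $d^r$ of content $\beta$ is the set partition $(B_1,\ldots,B_l)$ of the boxes where $B_1$ is the first $\beta_1$ sheet-columns, $B_2$ the next $\beta_2$, etc.; the $B_j$ are called rectangles of height $k$. Given $\delta\in\mathrm{OTyp}_r(dr)$, the polywrapping $D$ of $d^r$ of ordered content $\mathrm{pocon}(D)=\delta$ is obtained by dividing the $d$ rows, from top to bottom for $k=1,2,\ldots$, into consecutive groups of $k\,\mathrm{area}(\delta|_k)/r$ rows, and putting on the $k$th group the $k$-wrapping $D_k$ of content $\delta|_k$. Set $\mathrm{psgn}(D)=\hat{s}_r(\delta)$. $D$ is $r$-bounded if it has at most $r$ rectangles of each height, i.e. $\ell(\delta|_k)\le r$ for all $k$. **Bounded polywrapping block tabloids.** A bounded polywrapping block tabloid $T$ of shape $\sigma=d_1^{r_1}\cdots d_k^{r_k}$ and content $\tau$ is a list $(D^{(1)},\ldots,D^{(k)})$ where $D^{(i)}$ is an $r_i$-bounded polywrapping of $d_i^{r_i}$ and the multiset union of the blocks of $\mathrm{psort}(\mathrm{pocon}(D^{(i)}))$, $1\le i\le k$, equals $\tau$. Set $\mathrm{psgn}(T)=\prod_{i=1}^k\mathrm{psgn}(D^{(i)})$,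 i.e. $\prod_i\hat{s}_{r_i}(\mathrm{pocon}(D^{(i)}))$. *)

theory Defs
  imports Complex_Main "HOL-Library.Poly_Mapping" "HOL-Library.Multiset"
begin

section \<open>Formal power series in arbitrarily many commuting variables\<close>

text \<open>
  A monomial in variables of type \<open>'v\<close> is a finitely supported exponent function
  \<open>'v \<Rightarrow>\<^sub>0 nat\<close>, and a power series over the rationals assigns a coefficient to each monomial.
\<close>

typedef 'v mpseries = "UNIV :: (('v \<Rightarrow>\<^sub>0 nat) \<Rightarrow> rat) set"
  morphisms mcoeff Abs_mpseries ..

setup_lifting type_definition_mpseries

lemma mpseries_eqI: "(\<And>m. mcoeff f m = mcoeff g m) \<Longrightarrow> f = g"
  by transfer blast

lemma finite_splittings [simp]:
  fixes m :: "'v \<Rightarrow>\<^sub>0 nat"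
  shows "finite {(a, b). a + b = m}"
proof -
  let ?K = "Poly_Mapping.keys m"
  let ?N = "Max (Poly_Mapping.lookup m ` ?K)"
  let ?F = "{f. \<forall>x. (x \<in> ?K \<longrightarrow> f x \<in> {..?N}) \<and> (x \<notin> ?K \<longrightarrow> f x = 0)}"
  let ?S = "{a. \<exists>b. a + b = m}"
  have "Poly_Mapping.lookup ` ?S \<subseteq> ?F"
  proof safe
    fix a b :: "'v \<Rightarrow>\<^sub>0 nat" and x
    assume m: "m = a + b"
    have le: "Poly_Mapping.lookup a x \<le> Poly_Mapping.lookup m x"
      using m by (simp add: lookup_add)
    show "x \<in> Poly_Mapping.keys (a + b) \<Longrightarrow>
        Poly_Mapping.lookup a x \<le> Max (Poly_Mapping.lookup (a + b) ` Poly_Mapping.keys (a + b))"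
      using le m by (meson Max_ge finite_imageI finite_keys imageI order_trans)
    show "x \<notin> Poly_Mapping.keys (a + b) \<Longrightarrow> Poly_Mapping.lookup a x = 0"
      using le m by (simp add: in_keys_iff)
  qed
  moreover have "finite ?F"
    by (rule finite_set_of_finite_funs) auto
  ultimately have "finite (Poly_Mapping.lookup ` ?S)"
    by (rule finite_subset)
  then have "finite ?S"
    by (rule finite_imageD) (auto intro: inj_onI poly_mapping_eqI)
  moreover have "{(a, b). a + b = m} \<subseteq> (\<lambda>a. (a, m - a)) ` ?S"
    by (auto simp: image_iff)
  ultimately show ?thesis
    by (meson finite_imageI finite_subset)
qed

instantiation mpseries :: (type) comm_ring_1
begin

lift_definition zero_mpseries :: "'a mpseries" is "\<lambda>m. 0" .

lift_definition one_mpseries :: "'a mpseries" is "\<lambda>m. if m = 0 then 1 else 0" .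

lift_definition plus_mpseries :: "'a mpseries \<Rightarrow> 'a mpseries \<Rightarrow> 'a mpseries"
  is "\<lambda>f g m. f m + g m" .

lift_definition minus_mpseries :: "'a mpseries \<Rightarrow> 'a mpseries \<Rightarrow> 'a mpseries"
  is "\<lambda>f g m. f m - g m" .

lift_definition uminus_mpseries :: "'a mpseries \<Rightarrow> 'a mpseries"
  is "\<lambda>f m. - f m" .

lift_definition times_mpseries :: "'a mpseries \<Rightarrow> 'a mpseries \<Rightarrow> 'a mpseries"
  is "\<lambda>f g m. \<Sum>(a, b) | a + b = m. f a * g b" .

instance
proof
  fix f g h :: "'a mpseries"
  show "f * g * h = f * (g * h)"
  proof transfer
    fix f g h :: "('a \<Rightarrow>\<^sub>0 nat) \<Rightarrow> rat"
    show "(\<lambda>m. \<Sum>(a, b) | a + b = m. (\<Sum>(c, d) | c + d = a. f c * g d) * h b) =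
          (\<lambda>m. \<Sum>(a, b) | a + b = m. f a * (\<Sum>(c, d) | c + d = b. g c * h d))"
    proof
      fix m :: "'a \<Rightarrow>\<^sub>0 nat"
      let ?A = "\<lambda>m :: 'a \<Rightarrow>\<^sub>0 nat. {(a, b). a + b = m}"
      have "(\<Sum>(a, b)\<in>?A m. (\<Sum>(c, d)\<in>?A a. f c * g d) * h b) =
            (\<Sum>p\<in>?A m. \<Sum>q\<in>?A (fst p). f (fst q) * g (snd q) * h (snd p))"
        by (simp add: case_prod_unfold sum_distrib_right)
      also have "\<dots> = (\<Sum>(p, q)\<in>Sigma (?A m) (\<lambda>p. ?A (fst p)). f (fst q) * g (snd q) * h (snd p))"
        by (rule sum.Sigma) auto
      also have "\<dots> = (\<Sum>(p, q)\<in>Sigma (?A m) (\<lambda>p. ?A (snd p)). f (fst p) * (g (fst q) * h (snd q)))"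
        by (rule sum.reindex_bij_witness
              [where i = "\<lambda>(p, q). ((fst p + fst q, snd q), (fst p, fst q))"
                 and j = "\<lambda>(p, q). ((fst q, snd q + snd p), (snd q, snd p))"])
           (auto simp: algebra_simps)
      also have "\<dots> = (\<Sum>p\<in>?A m. \<Sum>q\<in>?A (snd p). f (fst p) * (g (fst q) * h (snd q)))"
        by (rule sum.Sigma [symmetric]) auto
      also have "\<dots> = (\<Sum>(a, b)\<in>?A m. f a * (\<Sum>(c, d)\<in>?A b. g c * h d))"
        by (simp add: case_prod_unfold sum_distrib_left)
      finally show "(\<Sum>(a, b)\<in>?A m. (\<Sum>(c, d)\<in>?A a. f c * g d) * h b) =
          (\<Sum>(a, b)\<in>?A m. f a * (\<Sum>(c, d)\<in>?A b. g c * h d))" .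
    qed
  qed
  show "f * g = g * f"
  proof transfer
    fix f g :: "('a \<Rightarrow>\<^sub>0 nat) \<Rightarrow> rat"
    show "(\<lambda>m. \<Sum>(a, b) | a + b = m. f a * g b) = (\<lambda>m. \<Sum>(a, b) | a + b = m. g a * f b)"
      by (rule ext, rule sum.reindex_bij_witness
            [where i = "\<lambda>(a, b). (b, a)" and j = "\<lambda>(a, b). (b, a)"])
         (auto simp: algebra_simps)
  qed
  show "1 * f = f"
  proof transfer
    fix f :: "('a \<Rightarrow>\<^sub>0 nat) \<Rightarrow> rat"
    show "(\<lambda>m. \<Sum>(a, b) | a + b = m. (if a = 0 then 1 else 0) * f b) = f"
    proof
      fix m :: "'a \<Rightarrow>\<^sub>0 nat"
      have "(\<Sum>(a, b) | a + b = m. (if a = 0 then 1 else 0) * f b) =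
            (\<Sum>(a, b)\<in>{(0 :: 'a \<Rightarrow>\<^sub>0 nat, m)}. (if a = 0 then 1 else 0) * f b)"
        by (rule sum.mono_neutral_right) (simp, auto split: if_splits)
      then show "(\<Sum>(a, b) | a + b = m. (if a = 0 then 1 else 0) * f b) = f m"
        by simp
    qed
  qed
  show "(f + g) * h = f * h + g * h"
    by transfer (simp add: case_prod_unfold ring_distribs sum.distrib)
  show "(0 :: 'a mpseries) \<noteq> 1"
    by transfer (auto simp: fun_eq_iff)
qed (transfer; simp add: algebra_simps fun_eq_iff)+

end

lift_definition mscale :: "rat \<Rightarrow> 'v mpseries \<Rightarrow> 'v mpseries"
  is "\<lambda>c f m. c * f m" .

interpretation mps: vector_space mscale
  by unfold_locales (transfer; simp add: algebra_simps fun_eq_iff)+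

text \<open>
  Substitution of \<open>x\<^sup>r\<close> for every variable \<open>x\<close>: the monomial \<open>m'\<close> becomes the monomial with all
  exponents multiplied by \<open>r\<close>.  For \<open>r \<ge> 1\<close> the sum has at most one term.
\<close>

definition power_subst :: "nat \<Rightarrow> 'v mpseries \<Rightarrow> 'v mpseries" where
  "power_subst r f =
     Abs_mpseries (\<lambda>m. \<Sum>m' | Poly_Mapping.map (\<lambda>e. r * e) m' = m. mcoeff f m')"


section \<open>Compositions and types\<close>

definition is_composition :: "nat list \<Rightarrow> bool" where
  "is_composition \<beta> \<longleftrightarrow> (\<forall>p\<in>set \<beta>. p \<ge> 1)"

definition is_partition :: "nat list \<Rightarrow> bool" where
  "is_partition \<beta> \<longleftrightarrow> is_composition \<beta> \<and> sorted_wrt (\<ge>) \<beta>"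

text \<open>
  A sequence \<open>\<delta>|\<^sub>1, \<delta>|\<^sub>2, \<dots>\<close> of compositions is a function on \<open>nat\<close> whose value at the unused
  index \<open>0\<close> is fixed to be the empty list.
\<close>

type_synonym otype = "nat \<Rightarrow> nat list"

definition osupp :: "otype \<Rightarrow> nat set" where
  "osupp \<delta> = {i. \<delta> i \<noteq> []}"

definition OTyp :: "nat \<Rightarrow> otype set" where
  "OTyp n = {\<delta>. \<delta> 0 = [] \<and> finite (osupp \<delta>) \<and> (\<forall>i. is_composition (\<delta> i)) \<and>
                (\<Sum>i\<in>osupp \<delta>. i * sum_list (\<delta> i)) = n}"

definition Typ :: "nat \<Rightarrow> otype set" where
  "Typ n = {\<tau>\<in>OTyp n. \<forall>i. is_partition (\<tau> i)}"

definition OTyp_r :: "nat \<Rightarrow> nat \<Rightarrow> otype set" where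
  "OTyp_r r n = {\<delta>\<in>OTyp n. \<forall>i. r dvd sum_list (\<delta> i)}"

definition area :: "otype \<Rightarrow> nat" where
  "area \<delta> = (\<Sum>i\<in>osupp \<delta>. sum_list (\<delta> i))"

definition psort :: "otype \<Rightarrow> otype" where
  "psort \<delta> = (\<lambda>i. rev (sort (\<delta> i)))"

text \<open>The block \<open>d\<^sup>r\<close> is represented by the pair \<open>(d, r)\<close>.\<close>

definition blocks :: "otype \<Rightarrow> (nat \<times> nat) multiset" where
  "blocks \<tau> = (\<Sum>d\<in>osupp \<tau>. image_mset (\<lambda>r. (d, r)) (mset (\<tau> d)))"


section \<open>Polysymmetric functions\<close>

text \<open>
  The variable \<open>x\<^sub>i\<^sub>j\<close> is the pair \<open>(i, j)\<close>.  Only the pairs with \<open>i, j \<ge> 1\<close> are variables of the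
  theory; the remaining pairs never occur in the series below.
\<close>

type_synonym pseries = "(nat \<times> nat) mpseries"

definition xvars :: "(nat \<times> nat) set" where
  "xvars = {(i, j). i \<ge> 1 \<and> j \<ge> 1}"

definition squarefree_monom :: "('v \<Rightarrow>\<^sub>0 nat) \<Rightarrow> bool" where
  "squarefree_monom m \<longleftrightarrow> (\<forall>v. Poly_Mapping.lookup m v \<le> 1)"

definition monom_deg :: "(nat \<times> nat \<Rightarrow>\<^sub>0 nat) \<Rightarrow> nat" where
  "monom_deg m = (\<Sum>(i, j)\<in>Poly_Mapping.keys m. i * Poly_Mapping.lookup m (i, j))"

text \<open>The elementary symmetric function \<open>e\<^sub>k(x\<^sub>i\<^sub>1, x\<^sub>i\<^sub>2, \<dots>)\<close>.\<close>

definition elem_sym :: "nat \<Rightarrow> nat \<Rightarrow> pseries" where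
  "elem_sym i k = Abs_mpseries (\<lambda>m.
     if squarefree_monom m \<and> Poly_Mapping.keys m \<subseteq> {(i, j) | j. j \<ge> 1} \<and>
        card (Poly_Mapping.keys m) = k
     then 1 else 0)"

definition e_otimes :: "otype \<Rightarrow> pseries" where
  "e_otimes \<delta> = (\<Prod>i\<in>osupp \<delta>. \<Prod>k\<leftarrow>\<delta> i. elem_sym i k)"

definition E_ser :: "nat \<Rightarrow> pseries" where
  "E_ser d = Abs_mpseries (\<lambda>m.
     if squarefree_monom m \<and> Poly_Mapping.keys m \<subseteq> xvars \<and> monom_deg m = d
     then (-1) ^ card (Poly_Mapping.keys m) else 0)"

definition E_block :: "nat \<times> nat \<Rightarrow> pseries" where
  "E_block = (\<lambda>(d, r). power_subst r (E_ser d))"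

definition E_type :: "otype \<Rightarrow> pseries" where
  "E_type \<sigma> = (\<Prod>b\<in>#blocks \<sigma>. E_block b)"

text \<open>
  The coefficient of \<open>e\<^sup>\<otimes>\<^sub>\<tau>\<close> in the expansion of \<open>f\<close> in the basis \<open>e\<^sup>\<otimes>\<^sub>\<rho>\<close>, \<open>\<rho>\<close> a type of \<open>n\<close>.  The
  polysymmetric functions of degree \<open>n\<close> are the span of these series, so it makes no difference
  that the expansion is taken in the space of all power series.
\<close>

definition e_otimes_coeff :: "nat \<Rightarrow> pseries \<Rightarrow> otype \<Rightarrow> rat" where
  "e_otimes_coeff n f \<tau> = mps.representation (e_otimes ` Typ n) f (e_otimes \<tau>)"


section \<open>The function \<open>s\<close>-hat\<close>

definition shat_tuple :: "nat \<Rightarrow> nat list \<Rightarrow> int" where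
  "shat_tuple r w =
     (let v = (\<lambda>i. (w ! i + i) mod r)
      in if inj_on v {..<r} then (-1) ^ card {(i, j). i < j \<and> j < r \<and> v i > v j} else 0)"

definition shat_comp :: "nat \<Rightarrow> nat list \<Rightarrow> int" where
  "shat_comp r \<beta> =
     (if length \<beta> \<le> r
      then \<Sum>w | length w = r \<and> filter (\<lambda>x. x \<noteq> 0) w = \<beta>. shat_tuple r w
      else 0)"

text \<open>Indices with empty \<open>\<delta>|\<^sub>i\<close> contribute the factor \<open>1\<close> and are left out of the product.\<close>

definition shat :: "nat \<Rightarrow> otype \<Rightarrow> int" where
  "shat r \<delta> = (\<Prod>i\<in>osupp \<delta>. shat_comp r (\<delta> i))"


section \<open>Wrappings and polywrappings\<close>

text \<open>
  A box is a pair (row, column), both counted from \<open>0\<close>.  In an array with \<open>r\<close> columns,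
  \<open>sheet_column k r t\<close> is the \<open>t\<close>-th column of a \<open>k\<close>-sheet in reading order (again from \<open>0\<close>).
\<close>

definition sheet_column :: "nat \<Rightarrow> nat \<Rightarrow> nat \<Rightarrow> (nat \<times> nat) set" where
  "sheet_column k r t = {k * (t div r) ..< k * (t div r) + k} \<times> {t mod r}"

text \<open>
  The list \<open>B\<^sub>1, \<dots>, B\<^sub>l\<close> of rectangles of the \<open>k\<close>-wrapping of content \<open>\<beta>\<close> of the array with
  \<open>r\<close> columns.  The number of rows is determined by \<open>k\<close>, \<open>r\<close> and the sum of \<open>\<beta>\<close>.
\<close>

definition wrapping :: "nat \<Rightarrow> nat \<Rightarrow> nat list \<Rightarrow> (nat \<times> nat) set list" where
  "wrapping k r \<beta> =
     map (\<lambda>j. \<Union>t\<in>{sum_list (take j \<beta>) ..< sum_list (take (Suc j) \<beta>)}. sheet_column k r t)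
       [0..<length \<beta>]"

definition shift_rows :: "nat \<Rightarrow> (nat \<times> nat) set \<Rightarrow> (nat \<times> nat) set" where
  "shift_rows a B = (\<lambda>(i, c). (a + i, c)) ` B"

definition group_start :: "nat \<Rightarrow> otype \<Rightarrow> nat \<Rightarrow> nat" where
  "group_start r \<delta> k = (\<Sum>i\<in>{1..<k}. i * (sum_list (\<delta> i) div r))"

text \<open>
  A polywrapping is the family of its wrappings \<open>D\<^sub>k\<close>.  The heights have to be recorded: for
  \<open>r = 1\<close>, the ordered types \<open>1\<^sup>(\<^sup>2\<^sup>)\<close> and \<open>2\<^sup>(\<^sup>1\<^sup>)\<close> give the same set partition of the two boxes.
\<close>

type_synonym polywrapping = "nat \<Rightarrow> (nat \<times> nat) set list"

definition polywrapping_of :: "nat \<Rightarrow> otype \<Rightarrow> polywrapping" where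
  "polywrapping_of r \<delta> = (\<lambda>k. map (shift_rows (group_start r \<delta> k)) (wrapping k r (\<delta> k)))"

definition polywrappings :: "nat \<times> nat \<Rightarrow> polywrapping set" where
  "polywrappings = (\<lambda>(d, r). polywrapping_of r ` OTyp_r r (d * r))"

definition pocon :: "nat \<times> nat \<Rightarrow> polywrapping \<Rightarrow> otype" where
  "pocon = (\<lambda>(d, r) D. THE \<delta>. \<delta> \<in> OTyp_r r (d * r) \<and> polywrapping_of r \<delta> = D)"

definition psgn :: "nat \<times> nat \<Rightarrow> polywrapping \<Rightarrow> int" where
  "psgn b D = shat (snd b) (pocon b D)"

definition r_bounded :: "nat \<Rightarrow> polywrapping \<Rightarrow> bool" where
  "r_bounded r D \<longleftrightarrow> (\<forall>k. length (D k) \<le> r)"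

lemma shift_rows_inj: "inj (\<lambda>(i, c). (a + i, c :: nat))" for a :: nat
  by (auto simp: inj_def)

lemma sheet_column_disjoint:
  assumes "t \<noteq> t'"
  shows "sheet_column k r t \<inter> sheet_column k r t' = {}"
proof (rule ccontr)
  assume "\<not> ?thesis"
  then obtain i where i: "k * (t div r) \<le> i" "i < k * (t div r) + k"
      "k * (t' div r) \<le> i" "i < k * (t' div r) + k" and m: "t mod r = t' mod r"
    by (auto simp: sheet_column_def)
  have "i div k = t div r" "i div k = t' div r"
    using i by (auto intro!: div_nat_eqI simp: algebra_simps)
  then show False
    using m assms by (metis div_mult_mod_eq)
qed

lemma card_sheet_columns: "card (\<Union>t\<in>{a..<b}. sheet_column k r t) = (b - a) * k"
proof -
  have "card (\<Union>t\<in>{a..<b}. sheet_column k r t) = (\<Sum>t\<in>{a..<b}. card (sheet_column k r t))"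
    by (rule card_UN_disjoint) (auto simp: sheet_column_disjoint, auto simp: sheet_column_def)
  then show ?thesis
    by (simp add: sheet_column_def card_cartesian_product)
qed

lemma wrapping_card: "map card (wrapping k r \<beta>) = map (\<lambda>p. p * k) \<beta>"
  by (rule nth_equalityI) (auto simp: wrapping_def card_sheet_columns take_Suc_conv_app_nth)

lemma polywrapping_of_card:
  "map card (polywrapping_of r \<delta> k) = map (\<lambda>p. p * k) (\<delta> k)"
proof -
  have "card (shift_rows a B) = card B" for a B
    unfolding shift_rows_def by (rule card_image) (metis inj_on_subset shift_rows_inj subset_UNIV)
  then show ?thesis
    using wrapping_card [of k r "\<delta> k"] by (simp add: polywrapping_of_def comp_def)
qed

lemma polywrapping_of_inj: "inj_on (polywrapping_of r) (OTyp n)"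
proof (rule inj_onI, rule ext)
  fix \<delta> \<epsilon> k
  assume mem: "\<delta> \<in> OTyp n" "\<epsilon> \<in> OTyp n" and "polywrapping_of r \<delta> = polywrapping_of r \<epsilon>"
  then have "map (\<lambda>p. p * k) (\<delta> k) = map (\<lambda>p. p * k) (\<epsilon> k)"
    by (metis polywrapping_of_card)
  moreover have "\<delta> 0 = \<epsilon> 0"
    using mem by (simp add: OTyp_def)
  ultimately show "\<delta> k = \<epsilon> k"
    by (cases "k = 0") (auto dest!: map_injective simp: inj_def)
qed

lemma pocon_polywrapping_of:
  assumes "\<delta> \<in> OTyp_r r (d * r)"
  shows "pocon (d, r) (polywrapping_of r \<delta>) = \<delta>"
  using assms polywrapping_of_inj [of r "d * r"]
  by (auto simp: pocon_def OTyp_r_def inj_on_def)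


section \<open>Bounded polywrapping block tabloids\<close>

text \<open>The list \<open>bs\<close> is the listing \<open>d\<^sub>1\<^sup>r\<^sup>1 \<cdots> d\<^sub>k\<^sup>r\<^sup>k\<close> of the blocks of the shape.\<close>

definition tabloids :: "(nat \<times> nat) list \<Rightarrow> otype \<Rightarrow> polywrapping list set" where
  "tabloids bs \<tau> =
     {T. list_all2 (\<lambda>b D. D \<in> polywrappings b \<and> r_bounded (snd b) D) bs T \<and>
         (\<Sum>(b, D)\<leftarrow>zip bs T. blocks (psort (pocon b D))) = blocks \<tau>}"

definition psgn_tabloid :: "(nat \<times> nat) list \<Rightarrow> polywrapping list \<Rightarrow> int" where
  "psgn_tabloid bs T = (\<Prod>(b, D)\<leftarrow>zip bs T. psgn b D)"

end

theory Submission
  imports Defs "HOL-Library.Product_Lexorder" "Jordan_Normal_Form.Determinant"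
    "HOL-Computational_Algebra.Formal_Power_Series"
begin

text \<open>
  Since \<open>\<Sum>\<^sub>d E\<^sub>d\<close> is the product of the factors \<open>1 - x\<^sub>i\<^sub>j\<close>, the series \<open>E\<^sub>d\<close> is a signed sum of
  products of elementary symmetric functions of the rows, and it remains to expand
  \<open>e\<^sub>k(x\<^sup>r)\<close>.  The generating function \<open>\<Prod>\<^sub>j (1 - x\<^sub>j\<^sup>r t\<^sup>r)\<close> is the product of \<open>f(\<zeta> t)\<close> over the
  \<open>r\<close>-th roots of unity \<open>\<zeta>\<close>, where \<open>f(t) = \<Prod>\<^sub>j (1 - x\<^sub>j t)\<close>; this product is the determinant of the
  circulant matrix formed by the sections of \<open>f\<close> modulo \<open>r\<close>.  Its Leibniz expansion has the
  coefficients \<open>shat_tuple\<close>.  Roots of unity can be avoided: the circulant determinant is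
  multiplicative in \<open>f\<close> and equals \<open>1 - x\<^sup>r t\<^sup>r\<close> for \<open>f = 1 - x t\<close>.  Finally, the \<open>e\<^sup>\<otimes>\<^sub>\<tau>\<close> are
  linearly independent because their lexicographically leading monomials are distinct.
\<close>

section \<open>Circulant determinants\<close>

lemma minus_one_power_card:
  assumes "finite A"
  shows "(-1 :: int) ^ card {x \<in> A. P x} = (\<Prod>x\<in>A. if P x then -1 else 1)"
proof -
  have "(\<Prod>x\<in>A. if P x then -1 else 1 :: int) = (\<Prod>x | x \<in> A \<and> P x. -1)"
    using assms by (simp add: prod.If_cases Int_def)
  then show ?thesis by simp
qed

text \<open>The inversion sign is a product of local signs over the pairs i < j. This product is
  multiplicative in the permutation and equals -1 on transpositions, so induction along
  transpositions identifies it with \<open>sign\<close>.\<close>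

lemma sign_eq_inversions:
  fixes p :: "nat \<Rightarrow> nat"
  assumes "p permutes {..<n}"
  shows "sign p = (-1) ^ card {(i, j). i < j \<and> j < n \<and> p i > p j}"
proof -
  define P where "P = {(i, j). i < j \<and> j < n}"
  define \<phi> :: "(nat \<Rightarrow> nat) \<Rightarrow> nat \<times> nat \<Rightarrow> int"
    where "\<phi> p x = (if p (fst x) > p (snd x) then -1 else 1)" for p x
  have "P \<subseteq> {..<n} \<times> {..<n}" by (auto simp: P_def)
  then have fin: "finite P" by (rule finite_subset) auto
  have inv: "(-1) ^ card {(i, j). i < j \<and> j < n \<and> p i > p j} = (\<Prod>x\<in>P. \<phi> p x)" for p
    using minus_one_power_card [OF fin, of "\<lambda>x. p (fst x) > p (snd x)"]
    by (simp add: \<phi>_def P_def case_prod_unfold)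
  have mult: "(\<Prod>x\<in>P. \<phi> (q \<circ> p) x) = (\<Prod>x\<in>P. \<phi> q x) * (\<Prod>x\<in>P. \<phi> p x)"
    if p: "p permutes {..<n}" and q: "q permutes {..<n}" for p q
  proof -
    \<comment> \<open>The action of \<open>p\<close> on two-element subsets, each written as an
      increasing pair; it permutes \<open>P\<close> and so reindexes the product.\<close>
    let ?s = "\<lambda>p :: nat \<Rightarrow> nat. \<lambda>x. (min (p (fst x)) (p (snd x)), max (p (fst x)) (p (snd x)))"
    have s: "?s p x \<in> P" if "p permutes {..<n}" "x \<in> P" for p x
    proof -
      have "p (fst x) < n" "p (snd x) < n" "p (fst x) \<noteq> p (snd x)"
        using that permutes_in_image [OF that(1)] inj_eq [OF permutes_inj [OF that(1)]]
        by (auto simp: P_def)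
      then show ?thesis by (auto simp: P_def min_def max_def)
    qed
    have ss: "?s q (?s p x) = x" if "x \<in> P" "\<And>i. q (p i) = i" for p q x
      using that by (auto simp: P_def min_def max_def)
    have "(\<Prod>x\<in>P. \<phi> (q \<circ> p) x) = (\<Prod>x\<in>P. \<phi> q (?s p x)) * (\<Prod>x\<in>P. \<phi> p x)"
      unfolding prod.distrib [symmetric]
    proof (rule prod.cong)
      fix x assume "x \<in> P"
      then have "p (fst x) \<noteq> p (snd x)" "q (p (fst x)) \<noteq> q (p (snd x))"
        using inj_eq [OF permutes_inj [OF p]] inj_eq [OF permutes_inj [OF q]] by (auto simp: P_def)
      then show "\<phi> (q \<circ> p) x = \<phi> q (?s p x) * \<phi> p x"
        by (auto simp: \<phi>_def min_def max_def)
    qed simp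
    also have "(\<Prod>x\<in>P. \<phi> q (?s p x)) = (\<Prod>x\<in>P. \<phi> q x)"
    proof (rule prod.reindex_bij_witness [where i = "?s (inv_into UNIV p)" and j = "?s p"])
      fix x assume "x \<in> P"
      then show "?s (inv_into UNIV p) (?s p x) = x" "?s p (?s (inv_into UNIV p) x) = x"
          "?s p x \<in> P" "?s (inv_into UNIV p) x \<in> P"
        using ss s p permutes_inv [OF p] permutes_inverses [OF p] by blast+
    qed simp
    finally show ?thesis .
  qed
  have transp: "(\<Prod>x\<in>P. \<phi> (transpose a b) x) = -1" if "a < b" "b < n" for a b
  proof -
    \<comment> \<open>The transposition of a < b has (b - a) + (b - a - 1) inversions, an odd
      number.\<close>
    have "{(i, j). i < j \<and> j < n \<and> transpose a b i > transpose a b j} =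
        (\<lambda>k. (a, k)) ` {a<..b} \<union> (\<lambda>k. (k, b)) ` {a<..<b}" (is "_ = ?A \<union> ?B")
      using that by (auto simp: transpose_def split: if_splits)
    moreover have "card (?A \<union> ?B) = card ?A + card ?B"
      by (rule card_Un_disjoint) auto
    moreover have "card ?A = b - a" "card ?B = b - a - 1"
      by (simp_all add: card_image inj_on_def)
    moreover have "odd ((b - a) + (b - a - 1))" using that by presburger
    ultimately show ?thesis by (simp add: inv [symmetric])
  qed
  have "sign p = (\<Prod>x\<in>P. \<phi> p x)"
    using assms finite_lessThan
  proof (induction rule: permutes_induct)
    case id
    show ?case by (auto intro!: prod.neutral simp: \<phi>_def P_def)
  next
    case (swap a b p)
    have "(\<Prod>x\<in>P. \<phi> (transpose a b) x) = -1"
      using swap.hyps transp by (metis lessThan_iff linorder_neqE_nat transpose_commute)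
    moreover have "sign (transpose a b \<circ> p) = - sign p"
      using swap.hyps permutes_imp_permutation [of "{..<n}" p]
      by (subst sign_compose) (simp_all add: permutation_swap_id sign_swap_id)
    ultimately show ?case
      using mult [OF \<open>p permutes {..<n}\<close> permutes_swap_id [of a "{..<n}" b]] swap
      by (simp only:)
  qed
  then show ?thesis by (simp add: inv)
qed

section \<open>Circulant matrices and their determinants\<close>

definition circulant :: "nat \<Rightarrow> 'a::comm_ring_1 fps \<Rightarrow> 'a fps mat" where
  "circulant r f = mat r r (\<lambda>(i, j). Abs_fps (\<lambda>n. if (n + i) mod r = j then fps_nth f n else 0))"

text \<open>Up to conjugation by the diagonal matrix of the powers t^i, \<open>circulant r f\<close>
  is multiplication by f on the power series in t, seen as a free module over the power series in
  t^r with basis 1, ..., t^(r-1). The determinant is therefore the norm of f.\<close>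

definition circ_norm :: "nat \<Rightarrow> 'a::comm_ring_1 fps \<Rightarrow> 'a fps" where
  "circ_norm r f = det (circulant r f)"

lemma circulant_carrier [simp]: "circulant r f \<in> carrier_mat r r"
  by (simp add: circulant_def)

text \<open>A term of exponent a in row i can only meet the middle index (a + i) mod r, so the sum
  over middle indices collapses to one term and the residues add up.\<close>

lemma circulant_mult:
  assumes "r \<ge> 1"
  shows "circulant r (f * g) = circulant r f * circulant r g"
proof (rule eq_matI)
  fix i j assume "i < dim_row (circulant r f * circulant r g)" "j < dim_col (circulant r f * circulant r g)"
  then have ij: "i < r" "j < r" by (simp_all add: circulant_def)
  show "circulant r (f * g) $$ (i, j) = (circulant r f * circulant r g) $$ (i, j)"
  proof (rule fps_ext)
    fix n
    have "fps_nth ((circulant r f * circulant r g) $$ (i, j)) n =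
      (\<Sum>l = 0..<r. \<Sum>a = 0..n. (if (a + i) mod r = l then fps_nth f a else 0) *
          (if (n - a + l) mod r = j then fps_nth g (n - a) else 0))"
      using ij by (simp add: circulant_def scalar_prod_def fps_sum_nth fps_mult_nth)
    also have "\<dots> = (\<Sum>a = 0..n. \<Sum>l = 0..<r. (if l = (a + i) mod r then fps_nth f a *
          (if (n - a + l) mod r = j then fps_nth g (n - a) else 0) else 0))"
      by (subst sum.swap) (intro sum.cong refl, auto)
    also have "\<dots> = (\<Sum>a = 0..n. if (n + i) mod r = j then fps_nth f a * fps_nth g (n - a) else 0)"
    proof (rule sum.cong)
      fix a assume "a \<in> {0..n}"
      then have "n - a + (a + i) = n + i" by simp
      then have "(n - a + (a + i) mod r) mod r = (n + i) mod r"
        by (metis mod_add_right_eq)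
      then show "(\<Sum>l = 0..<r. (if l = (a + i) mod r then fps_nth f a *
          (if (n - a + l) mod r = j then fps_nth g (n - a) else 0) else 0)) =
          (if (n + i) mod r = j then fps_nth f a * fps_nth g (n - a) else 0)"
        using assms by (simp add: sum.delta)
    qed simp
    also have "\<dots> = fps_nth (circulant r (f * g) $$ (i, j)) n"
      using ij by (simp add: circulant_def fps_mult_nth)
    finally show "fps_nth (circulant r (f * g) $$ (i, j)) n =
      fps_nth ((circulant r f * circulant r g) $$ (i, j)) n" ..
  qed
qed (simp_all add: circulant_def)

lemma circ_norm_mult:
  "r \<ge> 1 \<Longrightarrow> circ_norm r (f * g) = circ_norm r f * circ_norm r g"
  by (simp add: circ_norm_def circulant_mult det_mult [of _ r])

lemma circ_norm_1 [simp]: "circ_norm r (1 :: 'a::comm_ring_1 fps) = 1"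
proof -
  have "circulant r (1 :: 'a fps) = 1\<^sub>m r"
    by (rule eq_matI) (auto simp: circulant_def fps_eq_iff)
  then show ?thesis by (simp add: circ_norm_def)
qed

text \<open>Prescribing the values (w_i + i) mod r leaves at most one permutation, which exists
  exactly when these residues are distinct. Its sign is the inversion sign in
  \<open>shat_tuple\<close>.\<close>

lemma sum_sign_eq_shat_tuple:
  assumes "r \<ge> 1"
  shows "(\<Sum>p | p permutes {..<r} \<and> (\<forall>i<r. (w ! i + i) mod r = p i). sign p) = shat_tuple r w"
proof -
  define v where "v i = (w ! i + i) mod r" for i
  have v: "v i < r" for i using assms by (simp add: v_def)
  show ?thesis
  proof (cases "inj_on v {..<r}")
    case True
    define q where "q i = (if i < r then v i else i)" for i
    have "bij_betw v {..<r} {..<r}"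
      using True v by (simp add: bij_betw_def endo_inj_surj image_subsetI)
    then have q: "q permutes {..<r}"
      by (intro bij_imp_permutes) (auto simp: q_def intro: bij_betw_cong [THEN iffD1, rotated])
    have "{p. p permutes {..<r} \<and> (\<forall>i<r. (w ! i + i) mod r = p i)} = {q}"
    proof (intro equalityI subsetI; clarsimp)
      fix p assume "p permutes {..<r}" "\<forall>i<r. (w ! i + i) mod r = p i"
      then show "p = q"
        by (auto simp: q_def v_def fun_eq_iff permutes_not_in)
    qed (use q in \<open>auto simp: q_def v_def\<close>)
    moreover have "{(i, j). i < j \<and> j < r \<and> q i > q j} = {(i, j). i < j \<and> j < r \<and> v i > v j}"
      by (auto simp: q_def)
    ultimately show ?thesis
      using sign_eq_inversions [OF q] True by (simp add: shat_tuple_def v_def [abs_def])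
  next
    case False
    have "\<not> (p permutes {..<r} \<and> (\<forall>i<r. (w ! i + i) mod r = p i))" for p
    proof
      assume p: "p permutes {..<r} \<and> (\<forall>i<r. (w ! i + i) mod r = p i)"
      then have "inj_on p {..<r}" by (auto intro: permutes_inj_on)
      then have "inj_on v {..<r}"
        by (rule inj_on_cong [THEN iffD1, rotated]) (use p in \<open>simp add: v_def\<close>)
      with False show False ..
    qed
    then have "{p. p permutes {..<r} \<and> (\<forall>i<r. (w ! i + i) mod r = p i)} = {}" by blast
    with False show ?thesis by (simp only:) (simp add: shat_tuple_def v_def [abs_def])
  qed
qed

text \<open>In the Leibniz expansion, choosing the exponent w_i in row i forces the column (w_i + i)
  mod r. Summing over the permutations for a fixed exponent tuple of total k leaves the coefficient
  \<open>shat_tuple r w\<close>.\<close>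

lemma circ_norm_nth:
  fixes f :: "'a::comm_ring_1 fps"
  assumes "r \<ge> 1"
  shows "fps_nth (circ_norm r f) k =
    (\<Sum>w\<in>natpermute k r. of_int (shat_tuple r w) * (\<Prod>x\<leftarrow>w. fps_nth f x))"
proof -
  let ?P = "{p. p permutes {..<r}}"
  let ?c = "\<lambda>w p. \<forall>i<r. (w ! i + i) mod r = p i"
  obtain m where m: "r = Suc m" using assms by (cases r) auto
  then have set_r: "{0..<r} = {..<r}" "{0..<r} = {0..m}" "r = m + 1" by auto
  have fin: "finite ?P" by (rule finite_permutations) simp
  have sgn: "fps_nth (signof p * g) k = of_int (sign p) * fps_nth g k" for p and g :: "'a fps"
    by (auto simp: sign_def)
  have entry: "fps_nth (\<Prod>i = 0..<r. circulant r f $$ (i, p i)) k =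
      (\<Sum>w\<in>natpermute k r. if ?c w p then \<Prod>x\<leftarrow>w. fps_nth f x else 0)" if "p \<in> ?P" for p
  proof -
    have p: "p i < r" if "i < r" for i
      using that \<open>p \<in> ?P\<close> permutes_in_image by fastforce
    have "fps_nth (\<Prod>i = 0..<r. circulant r f $$ (i, p i)) k =
      (\<Sum>w\<in>natpermute k r. \<Prod>i = 0..<r. if (w ! i + i) mod r = p i then fps_nth f (w ! i) else 0)"
      unfolding set_r(2) fps_prod_nth set_r(3) [symmetric]
      by (intro sum.cong prod.cong refl) (use p m in \<open>simp add: circulant_def\<close>)
    also have "\<dots> = (\<Sum>w\<in>natpermute k r. if ?c w p then \<Prod>x\<leftarrow>w. fps_nth f x else 0)"
    proof (intro sum.cong refl)
      fix w assume "w \<in> natpermute k r"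
      then have "length w = r" by (simp add: natpermute_def)
      then have "(\<Prod>x\<leftarrow>w. fps_nth f x) = (\<Prod>i = 0..<r. fps_nth f (w ! i))"
        by (simp add: prod.list_conv_set_nth)
      then show "(\<Prod>i = 0..<r. if (w ! i + i) mod r = p i then fps_nth f (w ! i) else 0) =
        (if ?c w p then \<Prod>x\<leftarrow>w. fps_nth f x else 0)"
        by (auto intro!: prod_zero prod.cong)
    qed
    finally show ?thesis .
  qed
  have "fps_nth (circ_norm r f) k = (\<Sum>p\<in>?P. of_int (sign p) *
      (\<Sum>w\<in>natpermute k r. if ?c w p then \<Prod>x\<leftarrow>w. fps_nth f x else 0))"
    unfolding circ_norm_def det_def' [OF circulant_carrier] fps_sum_nth sgn set_r(1)
    by (intro sum.cong refl) (simp add: entry [unfolded set_r(1)])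
  also have "\<dots> = (\<Sum>w\<in>natpermute k r. \<Sum>p\<in>?P. if ?c w p then of_int (sign p) * (\<Prod>x\<leftarrow>w. fps_nth f x) else 0)"
    by (subst sum.swap) (simp add: sum_distrib_left if_distrib cong: if_cong)
  also have "\<dots> = (\<Sum>w\<in>natpermute k r. (\<Sum>p\<in>{p \<in> ?P. ?c w p}. of_int (sign p)) * (\<Prod>x\<leftarrow>w. fps_nth f x))"
    by (simp only: sum.inter_filter [OF fin, symmetric] sum_distrib_right)
  also have "\<dots> = (\<Sum>w\<in>natpermute k r. of_int (shat_tuple r w) * (\<Prod>x\<leftarrow>w. fps_nth f x))"
    unfolding sum_sign_eq_shat_tuple [OF assms, symmetric] of_int_sum by simp
  finally show ?thesis .
qed


section \<open>The norm of a linear factor\<close>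

lemma shat_tuple_replicate_0:
  "shat_tuple r (replicate r 0) = 1"
proof -
  have v: "(replicate r 0 ! i + i) mod r = i" if "i < r" for i
    using that by simp
  then have "inj_on (\<lambda>i. (replicate r 0 ! i + i) mod r) {..<r}"
    by (auto simp: inj_on_def)
  moreover have "{(i, j). i < j \<and> j < r \<and> (replicate r 0 ! i + i) mod r > (replicate r 0 ! j + j) mod r} = {}"
    using v by auto
  ultimately show ?thesis by (simp only: shat_tuple_def Let_def if_True) simp
qed

text \<open>Adding 1 gives the cyclic shift; its inversions are the pairs of the last position,
  which wraps around to 0, with each of the r - 1 earlier ones.\<close>

lemma shat_tuple_replicate_1:
  assumes "r \<ge> 1"
  shows "shat_tuple r (replicate r 1) = (-1) ^ (r - 1)"
proof -
  define v where "v i = (replicate r 1 ! i + i) mod r" for i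
  have v: "v i = (if i = r - 1 then 0 else Suc i)" if "i < r" for i
    using that by (auto simp: v_def)
  have inj: "inj_on v {..<r}"
    by (auto simp: inj_on_def v split: if_splits)
  have "{(i, j). i < j \<and> j < r \<and> v i > v j} = (\<lambda>i. (i, r - 1)) ` {..<r - 1}"
    by (auto simp: v split: if_splits)
  moreover have "card ((\<lambda>i. (i, r - 1)) ` {..<r - 1}) = r - 1"
    by (simp add: card_image inj_on_def)
  ultimately show ?thesis
    using inj by (simp only: shat_tuple_def Let_def v_def [symmetric] if_True)
qed

text \<open>An entry 1 followed cyclically by an entry 0 gives two equal residues. Distinct residues
  therefore propagate a single 1 around the whole cycle.\<close>

lemma shat_tuple_nonzero_01:
  assumes "length w = r" "set w \<subseteq> {0, 1}" "shat_tuple r w \<noteq> 0"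
  shows "w = replicate r 0 \<or> w = replicate r 1"
proof (cases "1 \<in> set w")
  case True
  then obtain i where i: "i < r" "w ! i = 1" using assms(1) by (metis in_set_conv_nth)
  have inj: "inj_on (\<lambda>i. (w ! i + i) mod r) {..<r}"
    using assms(3) by (auto simp: shat_tuple_def Let_def split: if_splits)
  have step: "w ! (Suc j mod r) = 1" if "j < r" "w ! j = 1" for j
  proof (rule ccontr)
    let ?j = "Suc j mod r"
    assume "w ! ?j \<noteq> 1"
    moreover have j: "?j < r" using that by simp
    ultimately have "w ! ?j = 0" using assms(1,2) nth_mem by fastforce
    then have "(w ! ?j + ?j) mod r = (w ! j + j) mod r" using that by simp
    with inj have "?j = j" by (rule inj_onD) (use j that in \<open>simp_all only: lessThan_iff\<close>)
    then show False using \<open>w ! ?j = 0\<close> that by simp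
  qed
  have "w ! ((i + m) mod r) = 1" for m
  proof (induction m)
    case (Suc m)
    then show ?case using step [of "(i + m) mod r"] i by (simp add: mod_Suc_eq)
  qed (use i in simp)
  note all = this
  have "w ! j = 1" if "j < r" for j
  proof -
    \<comment> \<open>The shift j + r - i leads from i to j modulo r and is not cut off at
      zero.\<close>
    have "i + (j + r - i) = j + r" using i by simp
    then have "(i + (j + r - i)) mod r = j" using that by simp
    with all show ?thesis by metis
  qed
  then show ?thesis using assms(1) by (auto intro!: nth_equalityI)
next
  case False
  then have "w = replicate r 0" using assms(1,2) by (intro replicate_eqI) auto
  then show ?thesis ..
qed

text \<open>Only tuples over {0, 1} can contribute, and of these only the two constant ones. They
  yield 1 and (-1)^(r-1) (-x)^r = -x^r, which replaces the factorization over roots of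
  unity.\<close>

lemma circ_norm_linear:
  fixes x :: "'a::comm_ring_1"
  assumes "r \<ge> 1"
  shows "circ_norm r (1 - fps_const x * fps_X) = 1 - fps_const (x ^ r) * fps_X ^ r"
proof (rule fps_ext)
  fix k
  let ?f = "1 - fps_const x * fps_X"
  let ?t = "\<lambda>w. of_int (shat_tuple r w) * (\<Prod>x\<leftarrow>w. fps_nth ?f x)"
  let ?N = "natpermute k r" and ?w0 = "replicate r 0" and ?w1 = "replicate r (1::nat)"
  have f: "fps_nth ?f j = (if j = 0 then 1 else if j = 1 then - x else 0)" for j
    by (simp add: fps_X_def)
  have zero: "?t w = 0" if w: "w \<in> ?N" "w \<notin> {?w0, ?w1}" for w
  proof (cases "set w \<subseteq> {0, 1}")
    case True
    then have "shat_tuple r w = 0"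
      using w shat_tuple_nonzero_01 [of w r] by (auto simp: natpermute_def)
    then show ?thesis by simp
  next
    case False
    then have "0 \<in> set (map (fps_nth ?f) w)" using f by force
    moreover have "prod_list xs = 0" if "0 \<in> set xs" for xs :: "'a list"
      using that by (induction xs) auto
    ultimately show ?thesis by (simp only: mult_zero_right)
  qed
  have "fps_nth (circ_norm r ?f) k = (\<Sum>w\<in>?N \<inter> {?w0, ?w1}. ?t w)"
    unfolding circ_norm_nth [OF assms]
    by (rule sum.mono_neutral_right) (use zero natpermute_finite in blast)+
  also have "\<dots> = (\<Sum>w\<in>{?w0, ?w1}. if w \<in> ?N then ?t w else 0)"
    by (subst Int_commute, rule sum.inter_restrict) simp
  also have "\<dots> = (if k = 0 then ?t ?w0 else 0) + (if k = r then ?t ?w1 else 0)"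
  proof -
    have "?w0 \<noteq> ?w1" "?w0 \<in> ?N \<longleftrightarrow> k = 0" "?w1 \<in> ?N \<longleftrightarrow> k = r"
      using assms by (auto simp: natpermute_def sum_list_replicate)
    then show ?thesis by simp
  qed
  also have "?t ?w0 = 1"
    by (simp add: shat_tuple_replicate_0 f)
  also have "?t ?w1 = - (x ^ r)"
  proof -
    have "?t ?w1 = (-1) ^ (r - 1) * (- x) ^ Suc (r - 1)"
      by (simp only: shat_tuple_replicate_1 [OF assms]) (use assms in \<open>simp add: f\<close>)
    also have "\<dots> = - (x ^ Suc (r - 1))"
      by (simp only: power_Suc2 mult.assoc [symmetric] power_mult_distrib [symmetric]) simp
    finally show ?thesis using assms by simp
  qed
  finally show "fps_nth (circ_norm r ?f) k = fps_nth (1 - fps_const (x ^ r) * fps_X ^ r) k"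
    using assms by (auto simp: fps_X_power_iff)
qed


section \<open>Power series in many variables\<close>

lemma keys_add_nat: "Poly_Mapping.keys (a + b) = Poly_Mapping.keys a \<union> Poly_Mapping.keys b"
  for a b :: "'v \<Rightarrow>\<^sub>0 nat"
  by (auto simp: in_keys_iff lookup_add)

lemma mcoeff_Abs [simp]: "mcoeff (Abs_mpseries f) = f"
  by (simp add: Abs_mpseries_inverse)

lemma mcoeff_0 [simp]: "mcoeff 0 m = 0"
  by (simp add: zero_mpseries.rep_eq)

lemma mcoeff_1: "mcoeff 1 m = (if m = 0 then 1 else 0)"
  by (simp add: one_mpseries.rep_eq)

lemma mcoeff_add [simp]: "mcoeff (f + g) m = mcoeff f m + mcoeff g m"
  by (simp add: plus_mpseries.rep_eq)

lemma mcoeff_uminus [simp]: "mcoeff (- f) m = - mcoeff f m"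
  by (simp add: uminus_mpseries.rep_eq)

lemma mcoeff_mscale [simp]: "mcoeff (mscale c f) m = c * mcoeff f m"
  by (simp add: mscale.rep_eq)

lemma mcoeff_mult: "mcoeff (f * g) m = (\<Sum>(a, b) | a + b = m. mcoeff f a * mcoeff g b)"
  by (simp add: times_mpseries.rep_eq)

lemma mcoeff_sum: "mcoeff (\<Sum>x\<in>A. f x) m = (\<Sum>x\<in>A. mcoeff (f x) m)"
  by (induction A rule: infinite_finite_induct) auto

text \<open>Serves products in which only one splitting of the monomial can contribute, as for
  leading monomials or for factors in disjoint sets of variables.\<close>

lemma mcoeff_mult_unique:
  assumes "a0 + b0 = m"
    and "\<And>a b. a + b = m \<Longrightarrow> mcoeff f a \<noteq> 0 \<Longrightarrow> mcoeff g b \<noteq> 0 \<Longrightarrow> a = a0"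
  shows "mcoeff (f * g) m = mcoeff f a0 * mcoeff g b0"
proof -
  have "mcoeff (f * g) m = (\<Sum>(a, b)\<in>{(a0, b0)}. mcoeff f a * mcoeff g b)"
    unfolding mcoeff_mult
  proof (rule sum.mono_neutral_right)
    show "\<forall>x\<in>{(a, b). a + b = m} - {(a0, b0)}. (case x of (a, b) \<Rightarrow> mcoeff f a * mcoeff g b) = 0"
    proof
      fix x assume "x \<in> {(a, b). a + b = m} - {(a0, b0)}"
      then obtain a b where x: "x = (a, b)" "a + b = m" "(a, b) \<noteq> (a0, b0)" by auto
      then have "a \<noteq> a0" using assms(1) by auto
      then show "(case x of (a, b) \<Rightarrow> mcoeff f a * mcoeff g b) = 0"
        using assms(2) x by auto
    qed
  qed (use assms(1) in auto)
  then show ?thesis by simp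
qed


section \<open>Setting variables to zero\<close>

definition trunc_vars :: "'v set \<Rightarrow> 'v mpseries \<Rightarrow> 'v mpseries" where
  "trunc_vars V f = Abs_mpseries (\<lambda>m. if Poly_Mapping.keys m \<subseteq> V then mcoeff f m else 0)"

lemma mcoeff_trunc_vars:
  "mcoeff (trunc_vars V f) m = (if Poly_Mapping.keys m \<subseteq> V then mcoeff f m else 0)"
  by (simp add: trunc_vars_def)

lemma trunc_vars_mult: "trunc_vars V (f * g) = trunc_vars V f * trunc_vars V g"
proof (rule mpseries_eqI)
  fix m
  show "mcoeff (trunc_vars V (f * g)) m = mcoeff (trunc_vars V f * trunc_vars V g) m"
  proof (cases "Poly_Mapping.keys m \<subseteq> V")
    case True
    then show ?thesis
      by (auto intro!: sum.cong simp: mcoeff_trunc_vars mcoeff_mult keys_add_nat)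
  next
    case False
    then have "mcoeff (trunc_vars V f) a * mcoeff (trunc_vars V g) b = 0" if "a + b = m" for a b
      using that by (auto simp: mcoeff_trunc_vars keys_add_nat)
    then have "mcoeff (trunc_vars V f * trunc_vars V g) m = 0"
      unfolding mcoeff_mult by (intro sum.neutral) auto
    with False show ?thesis by (simp add: mcoeff_trunc_vars)
  qed
qed

lemma trunc_vars_1: "trunc_vars V 1 = 1"
  by (rule mpseries_eqI) (simp add: mcoeff_trunc_vars mcoeff_1)

lemma trunc_vars_uminus: "trunc_vars V (- f) = - trunc_vars V f"
  by (rule mpseries_eqI) (simp add: mcoeff_trunc_vars)

lemma trunc_vars_power: "trunc_vars V (f ^ k) = trunc_vars V f ^ k"
  by (induction k) (simp_all add: trunc_vars_1 trunc_vars_mult)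

lemma trunc_vars_sum: "trunc_vars V (\<Sum>x\<in>A. f x) = (\<Sum>x\<in>A. trunc_vars V (f x))"
  by (rule mpseries_eqI) (simp add: mcoeff_trunc_vars mcoeff_sum)

lemma trunc_vars_prod_list: "trunc_vars V (\<Prod>x\<leftarrow>xs. f x) = (\<Prod>x\<leftarrow>xs. trunc_vars V (f x))"
  by (induction xs) (simp_all add: trunc_vars_1 trunc_vars_mult)

lemma trunc_vars_of_nat: "trunc_vars V (of_nat k) = of_nat k"
proof (induction k)
  case (Suc k)
  have "trunc_vars V (f + g) = trunc_vars V f + trunc_vars V g" for f g :: "'a mpseries"
    by (rule mpseries_eqI) (simp add: mcoeff_trunc_vars)
  with Suc show ?case by (simp add: trunc_vars_1)
qed (auto intro!: mpseries_eqI simp: mcoeff_trunc_vars)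

lemma trunc_vars_of_int: "trunc_vars V (of_int k) = of_int k"
  by (cases k rule: int_cases2) (simp_all add: trunc_vars_of_nat trunc_vars_uminus)

text \<open>Each monomial involves only finitely many variables, so an identity may be checked after
  setting all but finitely many variables to zero. This opens the way to induction on finite sets of
  variables.\<close>

lemma mpseries_eq_trunc_varsI:
  assumes "\<And>V. finite V \<Longrightarrow> trunc_vars V f = trunc_vars V g"
  shows "f = g"
proof (rule mpseries_eqI)
  fix m
  have "mcoeff (trunc_vars (Poly_Mapping.keys m) f) m = mcoeff (trunc_vars (Poly_Mapping.keys m) g) m"
    using assms by simp
  then show "mcoeff f m = mcoeff g m" by (simp add: mcoeff_trunc_vars)
qed


section \<open>Raising the variables to a power\<close>

definition monom_pow :: "nat \<Rightarrow> ('v \<Rightarrow>\<^sub>0 nat) \<Rightarrow> ('v \<Rightarrow>\<^sub>0 nat)" where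
  "monom_pow r m = Poly_Mapping.map (\<lambda>e. r * e) m"

lemma lookup_monom_pow [simp]: "Poly_Mapping.lookup (monom_pow r m) v = r * Poly_Mapping.lookup m v"
  unfolding monom_pow_def by transfer (simp add: when_def)

lemma monom_pow_add: "monom_pow r (a + b) = monom_pow r a + monom_pow r b"
  by (rule poly_mapping_eqI) (simp add: lookup_add algebra_simps)

lemma monom_pow_0 [simp]: "monom_pow r 0 = 0"
  by (rule poly_mapping_eqI) simp

lemma monom_pow_single [simp]: "monom_pow r (Poly_Mapping.single v k) = Poly_Mapping.single v (r * k)"
  by (rule poly_mapping_eqI) (simp add: lookup_single when_def)

lemma keys_monom_pow [simp]: "r \<ge> 1 \<Longrightarrow> Poly_Mapping.keys (monom_pow r m) = Poly_Mapping.keys m"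
  by (auto simp: in_keys_iff)

lemma monom_pow_inject [simp]: "r \<ge> 1 \<Longrightarrow> monom_pow r a = monom_pow r b \<longleftrightarrow> a = b"
  by (auto simp: poly_mapping_eq_iff fun_eq_iff)

lemma mcoeff_power_subst_monom_pow [simp]:
  "r \<ge> 1 \<Longrightarrow> mcoeff (power_subst r f) (monom_pow r m) = mcoeff f m"
  by (simp add: power_subst_def monom_pow_def [symmetric])

lemma mcoeff_power_subst_notin:
  "m \<notin> range (monom_pow r) \<Longrightarrow> mcoeff (power_subst r f) m = 0"
  by (auto simp: power_subst_def monom_pow_def [symmetric] intro!: sum.neutral)

lemma power_subst_eqI:
  assumes "r \<ge> 1" "\<And>m. mcoeff g (monom_pow r m) = mcoeff f m"
    "\<And>m. m \<notin> range (monom_pow r) \<Longrightarrow> mcoeff g m = 0"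
  shows "power_subst r f = g"
proof (rule mpseries_eqI)
  fix m show "mcoeff (power_subst r f) m = mcoeff g m"
  proof (cases "m \<in> range (monom_pow r)")
    case True
    then show ?thesis using assms by auto
  qed (simp add: assms mcoeff_power_subst_notin)
qed

section \<open>Substitution of r-th powers as a ring homomorphism\<close>

context
  fixes r :: nat
  assumes r: "r \<ge> 1"
begin

text \<open>Both factors live on the range of \<open>monom_pow r\<close>, which is additive and
  injective in the monomial, so the contributing splittings of \<open>monom_pow r m\<close>
  correspond to the splittings of \<open>m\<close>.\<close>

lemma power_subst_mult: "power_subst r (f * g) = power_subst r f * power_subst r g"
  for f g :: "'v mpseries"
proof (rule power_subst_eqI [OF r])
  let ?h = "\<lambda>(a, b). mcoeff (power_subst r f) a * mcoeff (power_subst r g) b"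
  fix m :: "'v \<Rightarrow>\<^sub>0 nat"
  have sub: "(\<lambda>(a, b). (monom_pow r a, monom_pow r b)) ` {(a, b). a + b = m} \<subseteq> {(a, b). a + b = monom_pow r m}"
    by (auto simp: monom_pow_add)
  have "mcoeff (power_subst r f * power_subst r g) (monom_pow r m) =
      (\<Sum>x\<in>(\<lambda>(a, b). (monom_pow r a, monom_pow r b)) ` {(a, b). a + b = m}. ?h x)"
    unfolding mcoeff_mult
  proof (rule sum.mono_neutral_right [OF _ sub])
    show "\<forall>x\<in>{(a, b). a + b = monom_pow r m} - (\<lambda>(a, b). (monom_pow r a, monom_pow r b)) ` {(a, b). a + b = m}. ?h x = 0"
    proof
      fix x
      assume "x \<in> {(a, b). a + b = monom_pow r m} -
        (\<lambda>(a, b). (monom_pow r a, monom_pow r b)) ` {(a, b). a + b = m}"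
      then obtain a b where x: "x = (a, b)" "a + b = monom_pow r m"
        and ni: "(a, b) \<notin> (\<lambda>(a, b). (monom_pow r a, monom_pow r b)) ` {(a, b). a + b = m}" by auto
      show "?h x = 0"
      proof (rule ccontr)
        assume "?h x \<noteq> 0"
        then have "mcoeff (power_subst r f) a \<noteq> 0" "mcoeff (power_subst r g) b \<noteq> 0"
          by (auto simp: x)
        then obtain a' b' where "a = monom_pow r a'" "b = monom_pow r b'"
          by (meson mcoeff_power_subst_notin rangeE)
        moreover from this have "a' + b' = m"
          using x r by (simp add: monom_pow_add [symmetric])
        ultimately show False using ni by auto
      qed
    qed
  qed simp
  also have "\<dots> = mcoeff (f * g) m"
    using r by (subst sum.reindex) (auto simp: inj_on_def mcoeff_mult intro!: sum.cong)
  finally show "mcoeff (power_subst r f * power_subst r g) (monom_pow r m) = mcoeff (f * g) m" .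
next
  fix m :: "'v \<Rightarrow>\<^sub>0 nat" assume m: "m \<notin> range (monom_pow r)"
  have "mcoeff (power_subst r f) a * mcoeff (power_subst r g) b = 0" if ab: "a + b = m" for a b
  proof (rule ccontr)
    assume "mcoeff (power_subst r f) a * mcoeff (power_subst r g) b \<noteq> 0"
    then have "mcoeff (power_subst r f) a \<noteq> 0" "mcoeff (power_subst r g) b \<noteq> 0" by auto
    then obtain a' b' where "a = monom_pow r a'" "b = monom_pow r b'"
      by (meson mcoeff_power_subst_notin rangeE)
    with ab m show False by (auto simp: monom_pow_add [symmetric])
  qed
  then show "mcoeff (power_subst r f * power_subst r g) m = 0"
    unfolding mcoeff_mult by (intro sum.neutral) auto
qed

lemma power_subst_0 [simp]: "power_subst r 0 = 0"
  by (rule power_subst_eqI [OF r]) auto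

lemma power_subst_1 [simp]: "power_subst r 1 = 1"
proof (rule power_subst_eqI [OF r])
  fix m
  show "mcoeff 1 (monom_pow r m) = mcoeff (1 :: 'a mpseries) m"
    using monom_pow_inject [OF r, of m 0] by (simp add: mcoeff_1 del: monom_pow_inject)
  show "m \<notin> range (monom_pow r) \<Longrightarrow> mcoeff (1 :: 'a mpseries) m = 0"
    by (metis mcoeff_1 monom_pow_0 rangeI)
qed

lemma power_subst_add: "power_subst r (f + g) = power_subst r f + power_subst r g"
  using r by (intro power_subst_eqI) (auto simp: mcoeff_power_subst_notin)

lemma power_subst_uminus: "power_subst r (- f) = - power_subst r f"
  using r by (intro power_subst_eqI) (auto simp: mcoeff_power_subst_notin)

lemma power_subst_sum: "power_subst r (\<Sum>x\<in>A. f x) = (\<Sum>x\<in>A. power_subst r (f x))"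
  by (induction A rule: infinite_finite_induct) (simp_all add: power_subst_add)

lemma power_subst_prod: "power_subst r (\<Prod>x\<in>A. f x) = (\<Prod>x\<in>A. power_subst r (f x))"
  by (induction A rule: infinite_finite_induct) (simp_all add: power_subst_mult)

lemma power_subst_power: "power_subst r (f ^ k) = power_subst r f ^ k"
  by (induction k) (simp_all add: power_subst_mult)

lemma trunc_vars_power_subst: "trunc_vars V (power_subst r f) = power_subst r (trunc_vars V f)"
  by (rule power_subst_eqI [OF r, symmetric])
     (use r in \<open>auto simp: mcoeff_trunc_vars mcoeff_power_subst_notin\<close>)

end

lemma power_subst_Suc_0 [simp]: "power_subst (Suc 0) f = f"
proof (rule power_subst_eqI)
  have [simp]: "monom_pow (Suc 0) m = m" for m :: "'a \<Rightarrow>\<^sub>0 nat"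
    by (rule poly_mapping_eqI) simp
  show "mcoeff f (monom_pow (Suc 0) m) = mcoeff f m" for m by simp
  show "m \<notin> range (monom_pow (Suc 0)) \<Longrightarrow> mcoeff f m = 0" for m
    by (metis \<open>\<And>m. monom_pow (Suc 0) m = m\<close> rangeI)
qed simp


section \<open>Elementary symmetric functions of powers\<close>

definition var_ser :: "'v \<Rightarrow> 'v mpseries" where
  "var_ser v = Abs_mpseries (\<lambda>m. if m = Poly_Mapping.single v 1 then 1 else 0)"

text \<open>The variable set is arbitrary, so that it can be cut down to a finite set and built up
  one variable at a time; \<open>elem_sym\<close> is the case of a single row.\<close>

definition elem_sym_on :: "'v set \<Rightarrow> nat \<Rightarrow> 'v mpseries" where
  "elem_sym_on A k = Abs_mpseries (\<lambda>m.
     if squarefree_monom m \<and> Poly_Mapping.keys m \<subseteq> A \<and> card (Poly_Mapping.keys m) = k then 1 else 0)"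

lemma elem_sym_eq: "elem_sym i k = elem_sym_on {(i, j) | j. j \<ge> 1} k"
  by (simp add: elem_sym_def elem_sym_on_def)

lemma mcoeff_var_ser_mult:
  "mcoeff (var_ser v * f) m =
    (if v \<in> Poly_Mapping.keys m then mcoeff f (m - Poly_Mapping.single v 1) else 0)"
proof (cases "v \<in> Poly_Mapping.keys m")
  case True
  then have "Poly_Mapping.single v 1 + (m - Poly_Mapping.single v 1) = m"
    by (intro poly_mapping_eqI) (auto simp: lookup_add lookup_minus lookup_single when_def in_keys_iff)
  from mcoeff_mult_unique [OF this, of "var_ser v" f] True show ?thesis
    by (simp add: var_ser_def split: if_splits)
next
  case False
  have "mcoeff (var_ser v) a * mcoeff f b = 0" if "a + b = m" for a b
    using False that by (auto simp: var_ser_def keys_add_nat)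
  then show ?thesis using False by (auto simp: mcoeff_mult intro!: sum.neutral)
qed

lemma var_ser_power:
  "var_ser v ^ r = Abs_mpseries (\<lambda>m. if m = Poly_Mapping.single v r then 1 else 0)"
proof (induction r)
  case (Suc r)
  show ?case
  proof (rule mpseries_eqI)
    fix m
    have "v \<in> Poly_Mapping.keys m \<and> m - Poly_Mapping.single v 1 = Poly_Mapping.single v r \<longleftrightarrow>
        m = Poly_Mapping.single v (Suc r)"
      by (auto simp: poly_mapping_eq_iff fun_eq_iff lookup_minus lookup_single when_def in_keys_iff split: if_splits)
    moreover have "mcoeff (var_ser v ^ Suc r) m =
        (if v \<in> Poly_Mapping.keys m \<and> m - Poly_Mapping.single v 1 = Poly_Mapping.single v r then 1 else 0)"
      by (simp add: mcoeff_var_ser_mult Suc.IH)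
    ultimately show "mcoeff (var_ser v ^ Suc r) m =
        mcoeff (Abs_mpseries (\<lambda>m. if m = Poly_Mapping.single v (Suc r) then 1 else 0)) m"
      by simp
  qed
qed (auto intro: mpseries_eqI simp: mcoeff_1)

lemma power_subst_var_ser: "r \<ge> 1 \<Longrightarrow> power_subst r (var_ser v) = var_ser v ^ r"
proof (rule power_subst_eqI)
  fix m assume r: "r \<ge> 1"
  have "monom_pow r m = Poly_Mapping.single v r \<longleftrightarrow> m = Poly_Mapping.single v 1"
    using monom_pow_inject [OF r, of m "Poly_Mapping.single v 1"] by simp
  then show "mcoeff (var_ser v ^ r) (monom_pow r m) = mcoeff (var_ser v) m"
    unfolding var_ser_power by (simp add: var_ser_def)
  have "Poly_Mapping.single v r \<in> range (monom_pow r)"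
    by (metis monom_pow_single mult.right_neutral rangeI)
  then show "m \<notin> range (monom_pow r) \<Longrightarrow> mcoeff (var_ser v ^ r) m = 0"
    unfolding var_ser_power by auto
qed

lemma trunc_vars_elem_sym_on: "trunc_vars V (elem_sym_on A k) = elem_sym_on (A \<inter> V) k"
  by (rule mpseries_eqI) (simp add: mcoeff_trunc_vars elem_sym_on_def)

lemma elem_sym_on_0 [simp]: "elem_sym_on A 0 = 1"
  by (rule mpseries_eqI) (auto simp: elem_sym_on_def mcoeff_1 squarefree_monom_def)

lemma elem_sym_on_empty_Suc [simp]: "elem_sym_on {} (Suc k) = 0"
  by (rule mpseries_eqI) (auto simp: elem_sym_on_def)

text \<open>Square-free monomials are split by whether they contain \<open>v\<close>; dividing by
  \<open>v\<close> matches those that do with the square-free monomials in \<open>A\<close> having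
  one variable less.\<close>

lemma elem_sym_on_insert:
  assumes "v \<notin> A"
  shows "elem_sym_on (insert v A) (Suc k) = elem_sym_on A (Suc k) + var_ser v * elem_sym_on A k"
proof (rule mpseries_eqI)
  fix m :: "'a \<Rightarrow>\<^sub>0 nat"
  let ?K = "Poly_Mapping.keys m"
  define m' where "m' = m - Poly_Mapping.single v 1"
  show "mcoeff (elem_sym_on (insert v A) (Suc k)) m =
      mcoeff (elem_sym_on A (Suc k) + var_ser v * elem_sym_on A k) m"
  proof (cases "v \<in> ?K")
    case False
    then have "?K \<subseteq> insert v A \<longleftrightarrow> ?K \<subseteq> A" by auto
    then show ?thesis using False by (simp add: elem_sym_on_def mcoeff_var_ser_mult m'_def [symmetric])
  next
    case True
    have lk: "Poly_Mapping.lookup m' x = (if x = v then Poly_Mapping.lookup m v - 1 else Poly_Mapping.lookup m x)" for x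
      by (simp add: m'_def lookup_minus lookup_single when_def)
    have "squarefree_monom m \<and> ?K \<subseteq> insert v A \<and> card ?K = Suc k \<longleftrightarrow>
        squarefree_monom m' \<and> Poly_Mapping.keys m' \<subseteq> A \<and> card (Poly_Mapping.keys m') = k"
    proof (cases "Poly_Mapping.lookup m v = 1")
      case one: True
      then have K: "Poly_Mapping.keys m' = ?K - {v}"
        by (auto simp: in_keys_iff lk split: if_splits)
      moreover have "Poly_Mapping.lookup m x \<le> 1 \<longleftrightarrow> Poly_Mapping.lookup m' x \<le> 1" for x
        using one by (simp add: lk)
      then have "squarefree_monom m \<longleftrightarrow> squarefree_monom m'"
        by (simp add: squarefree_monom_def)
      moreover have "card ?K = Suc (card (?K - {v}))"
        using True by (metis card.remove finite_keys)
      ultimately show ?thesis using assms by auto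
    next
      case False
      \<comment> \<open>If \<open>v\<close> has exponent at least 2, it survives the division, and
        neither side counts the monomial.\<close>
      then have "\<not> squarefree_monom m" "v \<in> Poly_Mapping.keys m'"
        using True by (auto simp: squarefree_monom_def in_keys_iff lk not_le intro!: exI [of _ v])
      then show ?thesis using assms by auto
    qed
    then have "mcoeff (elem_sym_on (insert v A) (Suc k)) m = mcoeff (elem_sym_on A k) m'"
      by (simp only: elem_sym_on_def mcoeff_Abs)
    moreover have "mcoeff (elem_sym_on A (Suc k)) m = 0"
      using True assms by (auto simp: elem_sym_on_def)
    ultimately show ?thesis
      using True by (simp add: mcoeff_var_ser_mult m'_def)
  qed
qed

text \<open>\<open>elem_gen r A\<close> is the product of the factors \<open>1 - x\<^sup>r t\<^sup>r\<close> over the variables \<open>x\<close> in \<open>A\<close>.\<close>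

definition elem_gen :: "nat \<Rightarrow> 'v set \<Rightarrow> 'v mpseries fps" where
  "elem_gen r A = Abs_fps (\<lambda>k.
     if r dvd k then (-1) ^ (k div r) * power_subst r (elem_sym_on A (k div r)) else 0)"

lemma elem_gen_empty:
  assumes "r \<ge> 1"
  shows "elem_gen r {} = 1"
proof (rule fps_ext)
  fix k show "fps_nth (elem_gen r ({} :: 'v set)) k = fps_nth 1 k"
  proof (cases "r dvd k \<and> k \<noteq> 0")
    case True
    then obtain l where l: "k = r * l" "l \<noteq> 0" by (auto elim: dvdE)
    then obtain l' where "l = Suc l'" by (cases l) auto
    then show ?thesis using assms True l(1) by (simp add: elem_gen_def)
  qed (use assms in \<open>auto simp: elem_gen_def\<close>)
qed

text \<open>Coefficientwise this is the recursion \<open>elem_sym_on_insert\<close> with all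
  variables raised to the power r; the alternating sign accounts for the minus sign in the new
  factor.\<close>

lemma elem_gen_insert:
  assumes "r \<ge> 1" "v \<notin> A"
  shows "elem_gen r (insert v A) = elem_gen r A * (1 - fps_const (var_ser v ^ r) * fps_X ^ r)"
proof (rule fps_ext)
  fix k
  have "fps_nth (elem_gen r A * (1 - fps_const (var_ser v ^ r) * fps_X ^ r)) k =
      fps_nth (elem_gen r A) k - var_ser v ^ r * (if k < r then 0 else fps_nth (elem_gen r A) (k - r))"
  proof -
    have "elem_gen r A * (1 - fps_const (var_ser v ^ r) * fps_X ^ r) =
        elem_gen r A - fps_const (var_ser v ^ r) * (fps_X ^ r * elem_gen r A)"
      by (simp only: right_diff_distrib mult_1_left mult_ac)
    then show ?thesis
      by (simp only: fps_sub_nth fps_mult_left_const_nth fps_X_power_mult_nth)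
  qed
  also have "\<dots> = fps_nth (elem_gen r (insert v A)) k"
  proof (cases "r dvd k")
    case False
    then show ?thesis by (auto simp: elem_gen_def dvd_minus_self)
  next
    case True
    then obtain l where l: "k = r * l" by (elim dvdE)
    show ?thesis
    proof (cases l)
      case 0
      then show ?thesis using assms l by (simp add: elem_gen_def)
    next
      case (Suc l')
      then have "k - r = r * l'" "\<not> k < r" using l by auto
      then show ?thesis
        using assms l Suc
        by (simp add: elem_gen_def elem_sym_on_insert power_subst_add power_subst_mult
            power_subst_var_ser algebra_simps)
    qed
  qed
  finally show "fps_nth (elem_gen r (insert v A)) k =
      fps_nth (elem_gen r A * (1 - fps_const (var_ser v ^ r) * fps_X ^ r)) k" ..
qed

text \<open>The norm is multiplicative and sends each factor 1 - x t to 1 - x^r t^r, so adding a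
  variable multiplies both sides by the same factor.\<close>

lemma circ_norm_elem_gen:
  assumes "r \<ge> 1" "finite A"
  shows "circ_norm r (elem_gen 1 A) = elem_gen r A"
  using assms(2)
proof (induction A)
  case (insert v A)
  then show ?case
    using assms(1) by (simp add: elem_gen_insert circ_norm_mult circ_norm_linear)
qed (use assms(1) in \<open>simp add: elem_gen_empty\<close>)

section \<open>The coefficients \<open>shat_tuple\<close> and \<open>shat_comp\<close>\<close>

lemma prod_list_minus_one_power:
  "(\<Prod>x\<leftarrow>w. (-1) ^ x * f x) = (-1) ^ sum_list w * (\<Prod>x\<leftarrow>w. f x)" for f :: "nat \<Rightarrow> 'a::comm_ring_1"
  by (induction w) (simp_all add: power_add mult_ac)

text \<open>Comparing coefficients of t^(rk) in \<open>circ_norm_elem_gen\<close> gives the identity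
  for the finite sets \<open>A \<inter> V\<close>, which suffices. The signs (-1)^x of the entries
  combine to (-1)^(rk) because each tuple has sum rk.\<close>

lemma power_subst_elem_sym_on_tuples:
  assumes r: "r \<ge> 1"
  shows "(-1) ^ k * power_subst r (elem_sym_on A k) =
    (-1) ^ (r * k) * (\<Sum>w\<in>natpermute (r * k) r. of_int (shat_tuple r w) * (\<Prod>x\<leftarrow>w. elem_sym_on A x))"
proof -
  have *: "(-1) ^ k * power_subst r (elem_sym_on A k) =
    (\<Sum>w\<in>natpermute (r * k) r. of_int (shat_tuple r w) * (\<Prod>x\<leftarrow>w. (-1) ^ x * elem_sym_on A x))"
  proof (rule mpseries_eq_trunc_varsI)
    have nth1: "fps_nth (elem_gen 1 B) = (\<lambda>x. (-1) ^ x * elem_sym_on B x)" for B :: "'a set"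
      by (simp add: elem_gen_def fun_eq_iff)
    fix V :: "'a set" assume V: "finite V"
    then have "finite (A \<inter> V)" by simp
    then have "fps_nth (circ_norm r (elem_gen 1 (A \<inter> V))) (r * k) = fps_nth (elem_gen r (A \<inter> V)) (r * k)"
      by (simp only: circ_norm_elem_gen [OF r])
    then have "(\<Sum>w\<in>natpermute (r * k) r. of_int (shat_tuple r w) * (\<Prod>x\<leftarrow>w. (-1) ^ x * elem_sym_on (A \<inter> V) x)) =
        (-1) ^ k * power_subst r (elem_sym_on (A \<inter> V) k)"
      unfolding circ_norm_nth [OF r] nth1 using r by (simp add: elem_gen_def)
    then show "trunc_vars V ((-1) ^ k * power_subst r (elem_sym_on A k)) =
      trunc_vars V (\<Sum>w\<in>natpermute (r * k) r. of_int (shat_tuple r w) * (\<Prod>x\<leftarrow>w. (-1) ^ x * elem_sym_on A x))"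
      by (simp add: trunc_vars_sum trunc_vars_mult trunc_vars_prod_list trunc_vars_power trunc_vars_uminus
          trunc_vars_1 trunc_vars_of_int trunc_vars_power_subst [OF r] trunc_vars_elem_sym_on)
  qed
  show ?thesis
    unfolding * sum_distrib_left prod_list_minus_one_power
    by (intro sum.cong refl) (simp add: natpermute_def mult_ac)
qed

definition compositions :: "nat \<Rightarrow> nat list set" where
  "compositions n = {\<beta>. is_composition \<beta> \<and> sum_list \<beta> = n}"

lemma finite_compositions [simp]: "finite (compositions n)"
proof (rule finite_subset)
  have "length \<beta> \<le> sum_list \<beta>" if "is_composition \<beta>" for \<beta>
    using that by (induction \<beta>) (auto simp: is_composition_def)
  then show "compositions n \<subseteq> {xs. set xs \<subseteq> {..n} \<and> length xs \<le> n}"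
    by (auto simp: compositions_def member_le_sum_list)
qed (simp add: finite_lists_length_le)

text \<open>Since \<open>elem_sym_on A 0 = 1\<close>, zero entries do not affect the product.
  Grouping the tuples by what remains after deleting zeros collects their signs into
  \<open>shat_comp\<close>.\<close>

lemma power_subst_elem_sym_on:
  assumes r: "r \<ge> 1"
  shows "(-1) ^ k * power_subst r (elem_sym_on A k) = (-1) ^ (r * k) *
    (\<Sum>\<beta>\<in>compositions (r * k). of_int (shat_comp r \<beta>) * (\<Prod>x\<leftarrow>\<beta>. elem_sym_on A x))"
proof -
  let ?N = "natpermute (r * k) r" and ?f = "filter (\<lambda>x :: nat. x \<noteq> 0)"
  have nz: "sum_list (?f w) = sum_list w" for w
    by (induction w) auto
  have pr: "(\<Prod>x\<leftarrow>?f w. elem_sym_on A x) = (\<Prod>x\<leftarrow>w. elem_sym_on A x)" for w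
    by (induction w) auto
  have "(\<Sum>w\<in>?N. of_int (shat_tuple r w) * (\<Prod>x\<leftarrow>w. elem_sym_on A x)) =
      (\<Sum>\<beta>\<in>compositions (r * k). \<Sum>w\<in>{w \<in> ?N. ?f w = \<beta>}. of_int (shat_tuple r w) * (\<Prod>x\<leftarrow>w. elem_sym_on A x))"
  proof (rule sum.group [symmetric])
    have "?f w \<in> compositions (r * k)" if "w \<in> ?N" for w
      using that nz [of w] by (simp add: compositions_def is_composition_def natpermute_def Suc_le_eq)
    then show "?f ` ?N \<subseteq> compositions (r * k)" by blast
  qed (simp_all add: natpermute_finite)
  also have "\<dots> = (\<Sum>\<beta>\<in>compositions (r * k). of_int (shat_comp r \<beta>) * (\<Prod>x\<leftarrow>\<beta>. elem_sym_on A x))"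
  proof (rule sum.cong)
    fix \<beta> assume \<beta>: "\<beta> \<in> compositions (r * k)"
    then have eq: "{w \<in> ?N. ?f w = \<beta>} = {w. length w = r \<and> ?f w = \<beta>}"
      using nz by (auto simp: natpermute_def compositions_def)
    \<comment> \<open>A composition longer than r comes from no r-tuple, so the default value 0
      agrees with the empty sum.\<close>
    have s: "shat_comp r \<beta> = (\<Sum>w | length w = r \<and> ?f w = \<beta>. shat_tuple r w)"
    proof (cases "length \<beta> \<le> r")
      case False
      then have "{w. length w = r \<and> ?f w = \<beta>} = {}" by auto
      with False show ?thesis by (simp only: shat_comp_def if_False sum.empty)
    qed (simp add: shat_comp_def)
    show "(\<Sum>w\<in>{w \<in> ?N. ?f w = \<beta>}. of_int (shat_tuple r w) * (\<Prod>x\<leftarrow>w. elem_sym_on A x)) =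
        of_int (shat_comp r \<beta>) * (\<Prod>x\<leftarrow>\<beta>. elem_sym_on A x)"
      unfolding eq s of_int_sum sum_distrib_right
      by (intro sum.cong refl) (use pr in auto)
  qed simp
  finally show ?thesis using power_subst_elem_sym_on_tuples [OF r, of k A] by simp
qed


section \<open>Expansion of the block series\<close>

definition restr :: "'v set \<Rightarrow> ('v \<Rightarrow>\<^sub>0 nat) \<Rightarrow> ('v \<Rightarrow>\<^sub>0 nat)" where
  "restr A m = Poly_Mapping.mapp (\<lambda>v e. if v \<in> A then e else 0) m"

lemma lookup_restr [simp]:
  "Poly_Mapping.lookup (restr A m) v = (if v \<in> A then Poly_Mapping.lookup m v else 0)"
  by (simp add: restr_def lookup_mapp when_def in_keys_iff)

lemma keys_restr [simp]: "Poly_Mapping.keys (restr A m) = Poly_Mapping.keys m \<inter> A"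
  by (auto simp: in_keys_iff split: if_splits)

lemma squarefree_restr: "squarefree_monom m \<longleftrightarrow> squarefree_monom (restr A m) \<and> squarefree_monom (restr (- A) m)"
  by (auto simp: squarefree_monom_def)

definition xrow :: "nat \<Rightarrow> (nat \<times> nat) set" where
  "xrow i = {(i, j) | j. j \<ge> 1}"

lemma elem_sym_xrow: "elem_sym i k = elem_sym_on (xrow i) k"
  by (simp add: elem_sym_eq xrow_def)

text \<open>The rows are disjoint, so a monomial can be distributed over the factors in only one
  way, and no coefficient exceeds 1.\<close>

lemma mcoeff_prod_elem_sym:
  assumes "finite I"
  shows "mcoeff (\<Prod>i\<in>I. elem_sym i (\<kappa> i)) m =
    (if squarefree_monom m \<and> Poly_Mapping.keys m \<subseteq> (\<Union>i\<in>I. xrow i) \<and>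
       (\<forall>i\<in>I. card (Poly_Mapping.keys m \<inter> xrow i) = \<kappa> i) then 1 else 0)"
  using assms
proof (induction I arbitrary: m)
  case empty
  show ?case by (auto simp: mcoeff_1 squarefree_monom_def)
next
  case (insert i I)
  have disj: "xrow i \<inter> (\<Union>i\<in>I. xrow i) = {}"
    using insert.hyps by (auto simp: xrow_def)
  have split: "restr (xrow i) m + restr (- xrow i) m = m"
    by (rule poly_mapping_eqI) (simp add: lookup_add)
  have "mcoeff (elem_sym i (\<kappa> i) * (\<Prod>i\<in>I. elem_sym i (\<kappa> i))) m =
      mcoeff (elem_sym i (\<kappa> i)) (restr (xrow i) m) * mcoeff (\<Prod>i\<in>I. elem_sym i (\<kappa> i)) (restr (- xrow i) m)"
  proof (rule mcoeff_mult_unique [OF split])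
    fix a b :: "nat \<times> nat \<Rightarrow>\<^sub>0 nat"
    assume ab: "a + b = m" "mcoeff (elem_sym i (\<kappa> i)) a \<noteq> 0"
      "mcoeff (\<Prod>i\<in>I. elem_sym i (\<kappa> i)) b \<noteq> 0"
    then have m: "m = a + b" and a: "Poly_Mapping.keys a \<subseteq> xrow i"
      by (auto simp: elem_sym_xrow elem_sym_on_def split: if_splits)
    have "Poly_Mapping.keys b \<subseteq> (\<Union>i\<in>I. xrow i)"
      using ab(3) by (simp add: insert.IH split: if_splits)
    then have b: "Poly_Mapping.keys b \<inter> xrow i = {}" using disj by blast
    show "a = restr (xrow i) m"
    proof (rule poly_mapping_eqI)
      fix v
      have "v \<in> xrow i \<Longrightarrow> Poly_Mapping.lookup b v = 0" "v \<notin> xrow i \<Longrightarrow> Poly_Mapping.lookup a v = 0"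
        using a b by (auto simp: in_keys_iff)
      then show "Poly_Mapping.lookup a v = Poly_Mapping.lookup (restr (xrow i) m) v"
        by (simp add: m lookup_add)
    qed
  qed
  moreover have "Poly_Mapping.keys m \<inter> - xrow i \<inter> xrow i' = Poly_Mapping.keys m \<inter> xrow i'" if "i' \<in> I" for i'
    using disj that by blast
  then have "(\<forall>i'\<in>I. card (Poly_Mapping.keys m \<inter> - xrow i \<inter> xrow i') = \<kappa> i') \<longleftrightarrow>
      (\<forall>i'\<in>I. card (Poly_Mapping.keys m \<inter> xrow i') = \<kappa> i')"
    by simp
  moreover have "Poly_Mapping.keys m \<inter> - xrow i \<subseteq> (\<Union>i\<in>I. xrow i) \<longleftrightarrow>
      Poly_Mapping.keys m \<subseteq> (\<Union>i\<in>insert i I. xrow i)"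
    by blast
  moreover have "mcoeff (elem_sym i k) m' = (if squarefree_monom m' \<and> Poly_Mapping.keys m' \<subseteq> xrow i \<and>
      card (Poly_Mapping.keys m') = k then 1 else 0)" for k m'
    by (simp add: elem_sym_xrow elem_sym_on_def)
  ultimately show ?case
    using insert.hyps by (simp add: insert.IH squarefree_restr [of m "xrow i"])
qed

lemma mcoeff_minus_one_power: "mcoeff ((-1) ^ k * f) m = (-1) ^ k * mcoeff f m"
  by (induction k) simp_all

text \<open>Weight 1 counts the variables of a monomial by rows; weight i gives the degree of a
  square-free monomial.\<close>

lemma sum_keys_xrows:
  assumes "finite I" "Poly_Mapping.keys m \<subseteq> (\<Union>i\<in>I. xrow i)"
  shows "(\<Sum>v\<in>Poly_Mapping.keys m. f (fst v)) = (\<Sum>i\<in>I. card (Poly_Mapping.keys m \<inter> xrow i) * (f i :: nat))"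
proof -
  have "(\<Sum>v\<in>Poly_Mapping.keys m. f (fst v)) = (\<Sum>v\<in>(\<Union>i\<in>I. Poly_Mapping.keys m \<inter> xrow i). f (fst v))"
    by (rule sum.cong) (use assms(2) in auto)
  also have "\<dots> = (\<Sum>i\<in>I. \<Sum>v\<in>Poly_Mapping.keys m \<inter> xrow i. f (fst v))"
    using assms(1) by (intro sum.UNION_disjoint) (auto simp: xrow_def)
  also have "\<dots> = (\<Sum>i\<in>I. \<Sum>v\<in>Poly_Mapping.keys m \<inter> xrow i. f i)"
    by (intro sum.cong refl) (auto simp: xrow_def)
  finally show ?thesis by simp
qed

text \<open>\<open>\<kappa> i\<close> stands for the number of variables of row i in a square-free
  monomial of degree d. Extensionality gives each such profile a single representative.\<close>

definition row_counts :: "nat \<Rightarrow> (nat \<Rightarrow> nat) set" where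
  "row_counts d = {\<kappa> \<in> {1..d} \<rightarrow>\<^sub>E {..d}. (\<Sum>i\<in>{1..d}. i * \<kappa> i) = d}"

lemma finite_row_counts [simp]: "finite (row_counts d)"
  unfolding row_counts_def by (rule finite_subset [of _ "{1..d} \<rightarrow>\<^sub>E {..d}"]) (auto intro: finite_PiE)

text \<open>A square-free monomial of degree d occurs in exactly one summand, that of its own row
  counts, and the signs of the rows multiply to the sign of its number of variables.\<close>

lemma E_ser_eq:
  "E_ser d = (\<Sum>\<kappa>\<in>row_counts d. \<Prod>i\<in>{1..d}. (-1) ^ \<kappa> i * elem_sym i (\<kappa> i))"
proof (rule mpseries_eqI)
  fix m :: "nat \<times> nat \<Rightarrow>\<^sub>0 nat"
  let ?K = "Poly_Mapping.keys m" and ?R = "\<Union>i\<in>{1..d}. xrow i"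
  define \<kappa>0 where "\<kappa>0 = restrict (\<lambda>i. card (?K \<inter> xrow i)) {1..d}"
  have mc: "mcoeff (\<Prod>i\<in>{1..d}. (-1) ^ \<kappa> i * elem_sym i (\<kappa> i)) m =
      (if squarefree_monom m \<and> ?K \<subseteq> ?R \<and> \<kappa> = \<kappa>0 then (-1) ^ card ?K else 0)"
    if "\<kappa> \<in> row_counts d" for \<kappa>
  proof -
    have "(\<forall>i\<in>{1..d}. card (?K \<inter> xrow i) = \<kappa> i) \<longleftrightarrow> \<kappa> = \<kappa>0"
    proof
      show "\<forall>i\<in>{1..d}. card (?K \<inter> xrow i) = \<kappa> i \<Longrightarrow> \<kappa> = \<kappa>0"
        using that unfolding \<kappa>0_def row_counts_def
        by (intro extensionalityI [of _ "{1..d}"]) (auto simp: PiE_iff)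
    qed (simp add: \<kappa>0_def)
    moreover have "(\<Sum>i\<in>{1..d}. \<kappa> i) = card ?K" if "?K \<subseteq> ?R" "\<kappa> = \<kappa>0"
      using sum_keys_xrows [OF _ that(1), of "\<lambda>_. 1"] that(2) by (simp add: \<kappa>0_def)
    ultimately show ?thesis
      by (auto simp: prod.distrib power_sum [symmetric] mcoeff_minus_one_power mcoeff_prod_elem_sym)
  qed
  have "squarefree_monom m \<and> ?K \<subseteq> ?R \<and> \<kappa>0 \<in> row_counts d \<longleftrightarrow>
      squarefree_monom m \<and> ?K \<subseteq> xvars \<and> monom_deg m = d" (is "?L \<longleftrightarrow> ?Q")
  proof (cases "squarefree_monom m")
    case sq: True
    have "Poly_Mapping.lookup m v = 1" if "v \<in> ?K" for v
      using sq that by (metis One_nat_def in_keys_iff le_antisym less_eq_Suc_le not_gr_zero squarefree_monom_def)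
    then have deg: "monom_deg m = (\<Sum>v\<in>?K. fst v)"
      unfolding monom_deg_def by (intro sum.cong) auto
    \<comment> \<open>A variable of row i contributes i to the degree, so only the rows 1 to d can
      occur.\<close>
    have sub: "?K \<subseteq> ?R" if "?Q"
    proof
      fix v assume v: "v \<in> ?K"
      then have "fst v \<le> monom_deg m" unfolding deg by (intro member_le_sum) auto
      with that v show "v \<in> ?R" by (force simp: xvars_def xrow_def)
    qed
    have degR: "monom_deg m = (\<Sum>i\<in>{1..d}. i * \<kappa>0 i)" if "?K \<subseteq> ?R"
      unfolding deg using sum_keys_xrows [OF _ that, of "\<lambda>i. i"] by (simp add: \<kappa>0_def mult.commute)
    have "\<kappa>0 i \<le> d" if "i \<in> {1..d}" "?K \<subseteq> ?R" "monom_deg m = d" for i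
    proof -
      have "\<kappa>0 i \<le> i * \<kappa>0 i" using that by simp
      also have "\<dots> \<le> (\<Sum>i\<in>{1..d}. i * \<kappa>0 i)"
        using that by (intro member_le_sum) auto
      finally show ?thesis using degR that by simp
    qed
    then have "\<kappa>0 \<in> row_counts d \<longleftrightarrow> monom_deg m = d" if "?K \<subseteq> ?R"
      using that degR by (auto simp: row_counts_def \<kappa>0_def)
    moreover have "?R \<subseteq> xvars" by (auto simp: xrow_def xvars_def)
    ultimately show ?thesis using sub by blast
  qed simp
  then have "mcoeff (E_ser d) m = (if squarefree_monom m \<and> ?K \<subseteq> ?R \<and> \<kappa>0 \<in> row_counts d then (-1) ^ card ?K else 0)"
    by (simp add: E_ser_def)
  also have "\<dots> = (\<Sum>\<kappa>\<in>row_counts d. if \<kappa> = \<kappa>0 then (if squarefree_monom m \<and> ?K \<subseteq> ?R then (-1) ^ card ?K else 0) else 0)"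
    by (simp add: sum.delta)
  also have "\<dots> = mcoeff (\<Sum>\<kappa>\<in>row_counts d. \<Prod>i\<in>{1..d}. (-1) ^ \<kappa> i * elem_sym i (\<kappa> i)) m"
    unfolding mcoeff_sum by (intro sum.cong refl) (simp only: mc, auto)
  finally show "mcoeff (E_ser d) m = mcoeff (\<Sum>\<kappa>\<in>row_counts d. \<Prod>i\<in>{1..d}. (-1) ^ \<kappa> i * elem_sym i (\<kappa> i)) m" .
qed

section \<open>Ordered types as families of compositions\<close>

lemma shat_comp_Nil [simp]: "shat_comp r [] = 1"
proof -
  have "{w. length w = r \<and> filter (\<lambda>x :: nat. x \<noteq> 0) w = []} = {replicate r 0}"
    by (auto simp: filter_empty_conv intro: replicate_eqI)
  then show ?thesis by (simp only: shat_comp_def) (simp add: shat_tuple_replicate_0)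
qed

text \<open>A nonempty entry in row i has area at least r, being a positive multiple of r. It takes
  up at least i r of the degree d r, whence i \<le> d.\<close>

lemma OTyp_r_osupp:
  assumes "\<delta> \<in> OTyp_r r (d * r)" "r \<ge> 1"
  shows "osupp \<delta> \<subseteq> {1..d}"
proof
  fix i assume i: "i \<in> osupp \<delta>"
  then have ne: "\<delta> i \<noteq> []" by (simp add: osupp_def)
  have "i \<noteq> 0"
  proof
    assume "i = 0"
    with assms ne show False by (simp add: OTyp_r_def OTyp_def)
  qed
  obtain x xs where "\<delta> i = x # xs" using ne by (cases "\<delta> i") auto
  moreover have "is_composition (\<delta> i)" using assms(1) by (simp add: OTyp_r_def OTyp_def)
  ultimately have "sum_list (\<delta> i) \<noteq> 0" by (simp add: is_composition_def)
  moreover have "r dvd sum_list (\<delta> i)" using assms(1) by (simp add: OTyp_r_def)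
  ultimately have "r \<le> sum_list (\<delta> i)" by (metis dvd_imp_le gr0I)
  then have "i * r \<le> i * sum_list (\<delta> i)" by simp
  also have "\<dots> \<le> (\<Sum>i\<in>osupp \<delta>. i * sum_list (\<delta> i))"
    using assms i by (intro member_le_sum) (auto simp: OTyp_r_def OTyp_def)
  also have "\<dots> = d * r" using assms by (auto simp: OTyp_r_def OTyp_def)
  finally show "i \<in> {1..d}" using assms(2) \<open>i \<noteq> 0\<close> by simp
qed

definition OTyp_r_fibres :: "nat \<Rightarrow> nat \<Rightarrow> ((nat \<Rightarrow> nat) \<times> otype) set" where
  "OTyp_r_fibres r d = Sigma (row_counts d) (\<lambda>\<kappa>. \<Pi>\<^sub>E i\<in>{1..d}. compositions (r * \<kappa> i))"

text \<open>The row counts are recovered as the areas divided by r, and the degree conditions on the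
  two sides differ by the factor r.\<close>

lemma bij_betw_OTyp_r:
  assumes r: "r \<ge> 1"
  shows "bij_betw (\<lambda>(\<kappa>, g) i. if i \<in> {1..d} then g i else []) (OTyp_r_fibres r d) (OTyp_r r (d * r))"
proof (rule bij_betw_byWitness
    [where f' = "\<lambda>\<delta>. (restrict (\<lambda>i. sum_list (\<delta> i) div r) {1..d}, restrict \<delta> {1..d})"])
  let ?h = "\<lambda>(\<kappa> :: nat \<Rightarrow> nat, g) i. if i \<in> {1..d} then g i else []"
  let ?h' = "\<lambda>\<delta>. (restrict (\<lambda>i. sum_list (\<delta> i) div r) {1..d}, restrict \<delta> {1..d})"
  show "\<forall>x\<in>OTyp_r_fibres r d. ?h' (?h x) = x"
  proof
    fix x assume "x \<in> OTyp_r_fibres r d"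
    then obtain \<kappa> g where x: "x = (\<kappa>, g)" "\<kappa> \<in> {1..d} \<rightarrow>\<^sub>E {..d}" "g \<in> (\<Pi>\<^sub>E i\<in>{1..d}. compositions (r * \<kappa> i))"
      by (auto simp: OTyp_r_fibres_def row_counts_def)
    then have "sum_list (g i) = r * \<kappa> i" if "i \<in> {1..d}" for i
      using that by (auto simp: PiE_iff compositions_def)
    then have "restrict (\<lambda>i. sum_list (?h x i) div r) {1..d} = \<kappa>"
      using x r by (intro extensionalityI [of _ "{1..d}"]) (auto simp: PiE_iff)
    moreover have "restrict (?h x) {1..d} = g"
      using x by (intro extensionalityI [of _ "{1..d}"]) (auto simp: PiE_iff)
    ultimately show "?h' (?h x) = x" by (simp add: x)
  qed
  show "\<forall>\<delta>\<in>OTyp_r r (d * r). ?h (?h' \<delta>) = \<delta>"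
  proof (intro ballI ext)
    fix \<delta> i assume "\<delta> \<in> OTyp_r r (d * r)"
    from OTyp_r_osupp [OF this r] have "i \<notin> {1..d} \<Longrightarrow> \<delta> i = []"
      unfolding osupp_def by blast
    then show "?h (?h' \<delta>) i = \<delta> i" by (cases "i \<in> {1..d}") simp_all
  qed
  show "?h ` OTyp_r_fibres r d \<subseteq> OTyp_r r (d * r)"
  proof
    fix \<delta> assume "\<delta> \<in> ?h ` OTyp_r_fibres r d"
    then obtain x where "x \<in> OTyp_r_fibres r d" and x: "\<delta> = ?h x" by blast
    moreover obtain \<kappa> g where \<kappa>g: "x = (\<kappa>, g)" by (cases x)
    ultimately have mem: "(\<kappa>, g) \<in> OTyp_r_fibres r d" by simp
    have \<delta>: "\<delta> = (\<lambda>i. if i \<in> {1..d} then g i else [])"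
      unfolding x \<kappa>g by simp
    from mem have \<kappa>: "(\<Sum>i\<in>{1..d}. i * \<kappa> i) = d"
      and g: "\<And>i. i \<in> {1..d} \<Longrightarrow> g i \<in> compositions (r * \<kappa> i)"
      by (auto simp: OTyp_r_fibres_def row_counts_def PiE_iff)
    have supp: "osupp \<delta> \<subseteq> {1..d}" by (auto simp: osupp_def \<delta> split: if_splits)
    then have "(\<Sum>i\<in>osupp \<delta>. i * sum_list (\<delta> i)) = (\<Sum>i\<in>{1..d}. i * sum_list (\<delta> i))"
      by (intro sum.mono_neutral_left) (auto simp: osupp_def)
    also have "\<dots> = (\<Sum>i\<in>{1..d}. r * (i * \<kappa> i))"
      by (intro sum.cong refl) (use g in \<open>auto simp: \<delta> compositions_def\<close>)
    also have "\<dots> = d * r" using \<kappa> by (simp add: sum_distrib_left [symmetric] mult.commute)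
    finally show "\<delta> \<in> OTyp_r r (d * r)"
      using finite_subset [OF supp] g
      by (auto simp: OTyp_r_def OTyp_def \<delta> compositions_def) (auto simp: is_composition_def)
  qed
  show "?h' ` OTyp_r r (d * r) \<subseteq> OTyp_r_fibres r d"
  proof
    fix x assume "x \<in> ?h' ` OTyp_r r (d * r)"
    then obtain \<delta> where \<delta>: "\<delta> \<in> OTyp_r r (d * r)" and x: "x = ?h' \<delta>" by blast
    define \<kappa> where "\<kappa> = restrict (\<lambda>i. sum_list (\<delta> i) div r) {1..d}"
    have \<kappa>: "r * \<kappa> i = sum_list (\<delta> i)" if "i \<in> {1..d}" for i
      using \<delta> that by (auto simp: \<kappa>_def OTyp_r_def)
    have "r * (\<Sum>i\<in>{1..d}. i * \<kappa> i) = (\<Sum>i\<in>{1..d}. i * sum_list (\<delta> i))"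
      unfolding sum_distrib_left by (intro sum.cong refl) (simp add: \<kappa> [symmetric])
    also have "\<dots> = (\<Sum>i\<in>osupp \<delta>. i * sum_list (\<delta> i))"
      by (rule sum.mono_neutral_right) (use OTyp_r_osupp [OF \<delta> r] in \<open>auto simp: osupp_def\<close>)
    also have "\<dots> = r * d" using \<delta> by (auto simp: OTyp_r_def OTyp_def)
    finally have sum: "(\<Sum>i\<in>{1..d}. i * \<kappa> i) = d" using r by simp
    have "\<kappa> i \<le> d" if "i \<in> {1..d}" for i
    proof -
      have "\<kappa> i \<le> i * \<kappa> i" using that by simp
      also have "\<dots> \<le> (\<Sum>i\<in>{1..d}. i * \<kappa> i)" using that by (intro member_le_sum) auto
      finally show ?thesis unfolding sum .
    qed
    then have "\<kappa> \<in> row_counts d"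
      using sum by (auto simp: row_counts_def \<kappa>_def)
    moreover have "restrict \<delta> {1..d} \<in> (\<Pi>\<^sub>E i\<in>{1..d}. compositions (r * \<kappa> i))"
      using \<delta> by (auto simp: \<kappa> compositions_def OTyp_r_def OTyp_def)
    ultimately show "x \<in> OTyp_r_fibres r d"
      by (simp add: x OTyp_r_fibres_def \<kappa>_def)
  qed
qed

lemma finite_OTyp_r:
  assumes "r \<ge> 1"
  shows "finite (OTyp_r r (d * r))"
proof -
  have "finite (OTyp_r_fibres r d)"
    unfolding OTyp_r_fibres_def by (intro finite_SigmaI finite_PiE) auto
  then show ?thesis using bij_betw_finite [OF bij_betw_OTyp_r [OF assms]] by blast
qed

text \<open>The factors \<open>power_subst r (elem_sym i (\<kappa> i))\<close> are expanded into
  compositions row by row and the product is multiplied out; \<open>bij_betw_OTyp_r\<close> turns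
  row counts with compositions into r-ordered types.\<close>

lemma E_block_eq:
  assumes r: "r \<ge> 1"
  shows "E_block (d, r) =
    (\<Sum>\<delta>\<in>OTyp_r r (d * r). of_int ((-1) ^ area \<delta> * shat r \<delta>) * e_otimes \<delta>)"
proof -
  let ?t = "\<lambda>i \<beta>. (-1) ^ sum_list \<beta> * (of_int (shat_comp r \<beta>) * (\<Prod>x\<leftarrow>\<beta>. elem_sym i x))"
  have product: "(\<Prod>i\<in>{1..d}. ?t i (\<delta> i)) = of_int ((-1) ^ area \<delta> * shat r \<delta>) * e_otimes \<delta>"
    if supp: "osupp \<delta> \<subseteq> {1..d}" for \<delta>
  proof -
    \<comment> \<open>Empty rows contribute the factor 1, by \<open>shat_comp_Nil\<close>.\<close>
    have "(\<Prod>i\<in>{1..d}. ?t i (\<delta> i)) = (\<Prod>i\<in>osupp \<delta>. ?t i (\<delta> i))"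
      by (rule prod.mono_neutral_right [OF _ supp]) (auto simp: osupp_def)
    then show ?thesis
      by (simp add: prod.distrib area_def shat_def e_otimes_def power_sum mult.assoc)
  qed
  have "E_block (d, r) = (\<Sum>\<kappa>\<in>row_counts d. \<Prod>i\<in>{1..d}. (-1) ^ \<kappa> i * power_subst r (elem_sym i (\<kappa> i)))"
    by (simp add: E_block_def E_ser_eq power_subst_sum [OF r] power_subst_prod [OF r]
        power_subst_mult [OF r] power_subst_power [OF r] power_subst_uminus [OF r] power_subst_1 [OF r])
  \<comment> \<open>The sign with exponent \<open>r * \<kappa> i\<close> moves inside the sum, where
    the exponent is the sum of the composition.\<close>
  also have "\<dots> = (\<Sum>\<kappa>\<in>row_counts d. \<Prod>i\<in>{1..d}. \<Sum>\<beta>\<in>compositions (r * \<kappa> i). ?t i \<beta>)"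
    unfolding elem_sym_xrow power_subst_elem_sym_on [OF r] sum_distrib_left
    by (intro sum.cong prod.cong refl) (simp add: compositions_def)
  also have "\<dots> = (\<Sum>\<kappa>\<in>row_counts d. \<Sum>g\<in>(\<Pi>\<^sub>E i\<in>{1..d}. compositions (r * \<kappa> i)). \<Prod>i\<in>{1..d}. ?t i (g i))"
    by (intro sum.cong refl prod_sum_PiE) auto
  also have "\<dots> = (\<Sum>(\<kappa>, g)\<in>OTyp_r_fibres r d. \<Prod>i\<in>{1..d}. ?t i (g i))"
    unfolding OTyp_r_fibres_def by (rule sum.Sigma) (auto intro: finite_PiE)
  also have "\<dots> = (\<Sum>x\<in>OTyp_r_fibres r d. \<Prod>i\<in>{1..d}. ?t i ((\<lambda>(\<kappa>, g) i. if i \<in> {1..d} then g i else []) x i))"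
    by (intro sum.cong refl) (auto intro!: prod.cong)
  also have "\<dots> = (\<Sum>\<delta>\<in>OTyp_r r (d * r). \<Prod>i\<in>{1..d}. ?t i (\<delta> i))"
    by (rule sum.reindex_bij_betw [OF bij_betw_OTyp_r [OF r]])
  also have "\<dots> = (\<Sum>\<delta>\<in>OTyp_r r (d * r). of_int ((-1) ^ area \<delta> * shat r \<delta>) * e_otimes \<delta>)"
    by (intro sum.cong refl product) (rule OTyp_r_osupp [OF _ r])
  finally show ?thesis .
qed


section \<open>Leading monomials\<close>

text \<open>The order on monomials is lexicographic: the smallest variable at which two exponents
  differ decides, and the pairs \<open>(i, j)\<close> are themselves ordered
  lexicographically.\<close>

definition has_lead :: "(nat \<times> nat \<Rightarrow>\<^sub>0 nat) \<Rightarrow> pseries \<Rightarrow> bool" where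
  "has_lead m f \<longleftrightarrow> mcoeff f m = 1 \<and> (\<forall>m'. mcoeff f m' \<noteq> 0 \<longrightarrow> m' \<le> m)"

lemma has_lead_1: "has_lead 0 1"
  by (auto simp: has_lead_def mcoeff_1 split: if_splits)

text \<open>The order is compatible with addition, so only the two leading terms multiply to the sum
  of the leading monomials, and no product of terms exceeds it.\<close>

lemma has_lead_mult:
  assumes "has_lead a f" "has_lead b g"
  shows "has_lead (a + b) (f * g)"
  unfolding has_lead_def
proof (intro conjI allI impI)
  have "mcoeff (f * g) (a + b) = mcoeff f a * mcoeff g b"
  proof (rule mcoeff_mult_unique [OF refl])
    fix a' b' assume eq: "a' + b' = a + b" and nz: "mcoeff f a' \<noteq> 0" "mcoeff g b' \<noteq> 0"
    then have "a' \<le> a" "b' \<le> b" using assms by (auto simp: has_lead_def)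
    then show "a' = a" using eq by (metis add_less_le_mono less_irrefl order_le_imp_less_or_eq)
  qed
  then show "mcoeff (f * g) (a + b) = 1" using assms by (simp add: has_lead_def)
next
  fix m assume nz: "mcoeff (f * g) m \<noteq> 0"
  obtain a' b' where "a' + b' = m" "mcoeff f a' \<noteq> 0" "mcoeff g b' \<noteq> 0"
  proof (rule ccontr)
    assume "\<not> thesis"
    then have "mcoeff f a' * mcoeff g b' = 0" if "a' + b' = m" for a' b'
      using that \<open>\<And>b' a'. \<lbrakk>a' + b' = m; _; _\<rbrakk> \<Longrightarrow> thesis\<close> by auto
    then have "mcoeff (f * g) m = 0" unfolding mcoeff_mult by (intro sum.neutral) auto
    with nz show False ..
  qed
  then show "m \<le> a + b" using assms by (auto simp: has_lead_def intro: add_mono)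
qed

lemma has_lead_unique: "has_lead m f \<Longrightarrow> has_lead m' f \<Longrightarrow> m = m'"
  unfolding has_lead_def by (metis antisym one_neq_zero)

text \<open>In a linear relation, the largest leading monomial among the series with non-zero
  coefficient occurs in no other of these series, so it cannot cancel.\<close>

lemma independent_if_distinct_leads:
  assumes lead: "\<And>f. f \<in> S \<Longrightarrow> has_lead (L f) f" and inj: "inj_on L S"
  shows "mps.independent S"
proof
  assume "mps.dependent S"
  then obtain t u where t: "finite t" "t \<subseteq> S" and sum: "(\<Sum>f\<in>t. mscale (u f) f) = 0"
    and nz: "\<exists>f\<in>t. u f \<noteq> 0"
    unfolding mps.dependent_explicit by blast
  let ?T = "{f \<in> t. u f \<noteq> 0}"
  have "Max (L ` ?T) \<in> L ` ?T" using t nz by (intro Max_in) auto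
  then obtain f0 where f0: "f0 \<in> t" "u f0 \<noteq> 0" "L f0 = Max (L ` ?T)" by auto
  have zero: "u f * mcoeff f (L f0) = 0" if "f \<in> t" "f \<noteq> f0" for f
  proof (rule ccontr)
    assume ne: "u f * mcoeff f (L f0) \<noteq> 0"
    then have "L f0 \<le> L f" using lead t that by (force simp: has_lead_def)
    moreover have "L f \<le> L f0" unfolding f0 using ne that t by (intro Max_ge) auto
    ultimately have "L f = L f0" by order
    then show False using inj_onD [OF inj, of f f0] f0(1) t that by blast
  qed
  have "(\<Sum>f\<in>t - {f0}. u f * mcoeff f (L f0)) = 0"
    by (rule sum.neutral) (use zero in blast)
  then have "mcoeff (\<Sum>f\<in>t. mscale (u f) f) (L f0) = u f0 * mcoeff f0 (L f0)"
    unfolding sum.remove [OF t(1) f0(1)] by (simp add: mcoeff_sum)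
  then show False using sum f0 lead [of f0] t by (auto simp: has_lead_def)
qed

section \<open>Leading monomials of products of elementary symmetric functions\<close>

definition row_lead :: "nat \<Rightarrow> nat \<Rightarrow> (nat \<times> nat \<Rightarrow>\<^sub>0 nat)" where
  "row_lead i k = (\<Sum>j\<in>{1..k}. Poly_Mapping.single (i, j) 1)"

lemma lookup_row_lead:
  "Poly_Mapping.lookup (row_lead i k) (i', j) = (if i' = i \<and> 1 \<le> j \<and> j \<le> k then 1 else 0)"
  by (auto simp: row_lead_def lookup_sum lookup_single when_def sum.delta)

lemma has_lead_elem_sym: "has_lead (row_lead i k) (elem_sym i k)"
  unfolding has_lead_def
proof (intro conjI allI impI)
  have K: "Poly_Mapping.keys (row_lead i k) = Pair i ` {1..k}"
    by (auto simp: in_keys_iff lookup_row_lead split: if_splits)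
  then have "card (Poly_Mapping.keys (row_lead i k)) = k"
    by (simp add: card_image inj_on_def)
  then show "mcoeff (elem_sym i k) (row_lead i k) = 1"
    by (auto simp: elem_sym_def K squarefree_monom_def lookup_row_lead)
next
  fix m assume "mcoeff (elem_sym i k) m \<noteq> 0"
  then have sq: "squarefree_monom m" and K: "Poly_Mapping.keys m \<subseteq> {(i, j) | j. j \<ge> 1}"
    and card: "card (Poly_Mapping.keys m) = k"
    by (auto simp: elem_sym_def split: if_splits)
  show "m \<le> row_lead i k"
  proof (rule ccontr)
    assume "\<not> m \<le> row_lead i k"
    then have "row_lead i k < m" by simp
    \<comment> \<open>At the first difference \<open>m\<close> has a variable x_ij with j > k. It
      then also contains x_i1, ..., x_ik, which is one variable too many.\<close>
    then obtain v where v: "Poly_Mapping.lookup (row_lead i k) v < Poly_Mapping.lookup m v"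
      and eq: "\<And>v'. v' < v \<Longrightarrow> Poly_Mapping.lookup (row_lead i k) v' = Poly_Mapping.lookup m v'"
      unfolding less_poly_mapping.rep_eq less_fun_def by blast
    from v have "v \<in> Poly_Mapping.keys m" by (auto simp: in_keys_iff)
    with K obtain j where j: "v = (i, j)" "j \<ge> 1" by auto
    have "Poly_Mapping.lookup m v \<le> 1" using sq unfolding squarefree_monom_def by blast
    with v j have "k < j" by (auto simp: lookup_row_lead split: if_splits)
    have "Pair i ` {1..k} \<subseteq> Poly_Mapping.keys m"
    proof clarify
      fix j' assume j': "j' \<in> {1..k}"
      then have "(i, j') < v" using \<open>k < j\<close> j by simp
      from eq [OF this] j' show "(i, j') \<in> Poly_Mapping.keys m"
        by (simp add: lookup_row_lead in_keys_iff)
    qed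
    then have "card (insert v (Pair i ` {1..k})) \<le> card (Poly_Mapping.keys m)"
      using \<open>v \<in> Poly_Mapping.keys m\<close> by (intro card_mono) auto
    moreover have "card (insert v (Pair i ` {1..k})) = Suc k"
      using \<open>k < j\<close> j by (subst card_insert_disjoint) (auto simp: card_image inj_on_def)
    ultimately show False using card by simp
  qed
qed

text \<open>Indexing by multisets of blocks turns the union of contents into the product of
  series.\<close>

definition e_blocks :: "(nat \<times> nat) multiset \<Rightarrow> pseries" where
  "e_blocks M = (\<Prod>(i, k)\<in>#M. elem_sym i k)"

definition lead_blocks :: "(nat \<times> nat) multiset \<Rightarrow> (nat \<times> nat \<Rightarrow>\<^sub>0 nat)" where
  "lead_blocks M = (\<Sum>(i, k)\<in>#M. row_lead i k)"

lemma has_lead_e_blocks: "has_lead (lead_blocks M) (e_blocks M)"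
  unfolding lead_blocks_def e_blocks_def
  by (induction M) (auto simp: has_lead_1 intro: has_lead_mult has_lead_elem_sym)

text \<open>The exponents along row i form the conjugate of the partition given by the blocks of row
  i.\<close>

lemma lookup_lead_blocks:
  "j \<ge> 1 \<Longrightarrow> Poly_Mapping.lookup (lead_blocks M) (i, j) = size {#b \<in># M. fst b = i \<and> j \<le> snd b#}"
  unfolding lead_blocks_def
  by (induction M) (auto simp: lookup_add lookup_row_lead)

text \<open>Differences of consecutive exponents recover the multiplicities of the blocks. A block
  with second entry 0 would leave no trace, which the hypotheses exclude.\<close>

lemma lead_blocks_inj:
  assumes "lead_blocks M = lead_blocks N" "\<forall>b\<in>#M. snd b \<ge> 1" "\<forall>b\<in>#N. snd b \<ge> 1"
  shows "M = N"
proof (rule multiset_eqI)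
  have count: "size {#b \<in># M. fst b = i \<and> k \<le> snd b#} =
      count M (i, k) + size {#b \<in># M. fst b = i \<and> Suc k \<le> snd b#}" for M :: "(nat \<times> nat) multiset" and i k
    by (induction M) auto
  fix b
  show "count M b = count N b"
  proof (cases "snd b \<ge> 1")
    case True
    have "size {#c \<in># M. fst c = fst b \<and> k \<le> snd c#} = size {#c \<in># N. fst c = fst b \<and> k \<le> snd c#}"
      if "k \<ge> 1" for k
      using lookup_lead_blocks [OF that, of M "fst b"] lookup_lead_blocks [OF that, of N "fst b"]
        assms(1) by simp
    from this [of "snd b"] this [of "Suc (snd b)"] True show ?thesis
      using count [where M = M and i = "fst b" and k = "snd b"]
        count [where M = N and i = "fst b" and k = "snd b"] by simp
  next
    case False
    then have "b \<notin># M" "b \<notin># N" using assms(2,3) by auto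
    then show ?thesis by (simp add: not_in_iff)
  qed
qed

section \<open>Types and their multisets of blocks\<close>

lemma e_otimes_eq: "e_otimes \<delta> = e_blocks (blocks \<delta>)"
proof -
  have "e_blocks (\<Sum>d\<in>A. image_mset (\<lambda>r. (d, r)) (mset (\<delta> d))) = (\<Prod>d\<in>A. \<Prod>k\<leftarrow>\<delta> d. elem_sym d k)" for A
    by (induction A rule: infinite_finite_induct)
       (simp_all add: e_blocks_def image_mset.compositionality comp_def prod_mset_prod_list [symmetric])
  then show ?thesis by (simp add: e_otimes_def blocks_def)
qed

text \<open>Weight 1 gives the area of the type, weight i its degree.\<close>

lemma sum_mset_blocks: "(\<Sum>(i, k)\<in>#blocks \<delta>. c i * k) = (\<Sum>i\<in>osupp \<delta>. c i * sum_list (\<delta> i))"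
  for c :: "nat \<Rightarrow> nat"
proof -
  have "(\<Sum>(i, k)\<in># (\<Sum>d\<in>A. image_mset (\<lambda>r. (d, r)) (mset (\<delta> d))). c i * k) = (\<Sum>i\<in>A. c i * sum_list (\<delta> i))" for A
    by (induction A rule: infinite_finite_induct)
       (simp_all add: image_mset.compositionality comp_def sum_mset_distrib_left [symmetric] sum_mset_sum_list)
  then show ?thesis by (simp add: blocks_def)
qed

lemma area_eq_sum_blocks: "area \<delta> = (\<Sum>(i, k)\<in>#blocks \<delta>. k)"
  using sum_mset_blocks [of "\<lambda>_. 1" \<delta>] by (simp add: area_def)

lemma count_blocks:
  assumes "finite (osupp \<delta>)"
  shows "count (blocks \<delta>) (d, k) = count (mset (\<delta> d)) k"
proof -
  have "count (image_mset (\<lambda>r. (d', r)) M) (d, k) = (if d' = d then count M k else 0)"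
    for d' :: nat and M :: "nat multiset"
    by (induction M) auto
  then have "count (blocks \<delta>) (d, k) = (\<Sum>d'\<in>osupp \<delta>. if d' = d then count (mset (\<delta> d')) k else 0)"
    unfolding blocks_def count_sum by simp
  also have "\<dots> = count (mset (\<delta> d)) k"
    using assms by (auto simp: sum.delta osupp_def)
  finally show ?thesis .
qed

lemma OTyp_blocks_pos:
  assumes "\<delta> \<in> OTyp n" "b \<in># blocks \<delta>"
  shows "fst b \<ge> 1 \<and> snd b \<ge> 1"
proof -
  have "finite (osupp \<delta>)" using assms(1) by (simp add: OTyp_def)
  then have "b \<in># blocks \<delta> \<longleftrightarrow> snd b \<in> set (\<delta> (fst b))"
    using count_blocks [of \<delta> "fst b" "snd b"] by (metis count_greater_zero_iff prod.collapse set_mset_mset)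
  with assms(2) have b: "snd b \<in> set (\<delta> (fst b))" by simp
  have "fst b \<noteq> 0"
  proof
    assume "fst b = 0"
    with b assms(1) show False by (simp add: OTyp_def)
  qed
  then show ?thesis using b assms(1) by (auto simp: OTyp_def is_composition_def)
qed

lemma OTyp_blocks_degree: "\<delta> \<in> OTyp n \<Longrightarrow> (\<Sum>(i, k)\<in>#blocks \<delta>. i * k) = n"
  by (simp add: sum_mset_blocks OTyp_def)

lemma blocks_psort: "blocks (psort \<delta>) = blocks \<delta>"
proof -
  have "osupp (psort \<delta>) = osupp \<delta>"
    by (simp add: osupp_def psort_def) (metis length_0_conv length_sort)
  then show ?thesis by (simp add: blocks_def psort_def)
qed

text \<open>The blocks determine the multiset of parts of each entry, and a partition is determined
  by that multiset.\<close>

lemma blocks_inj_on_Typ: "inj_on blocks (Typ n)"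
proof (intro inj_onI ext)
  fix \<sigma> \<tau> d assume mem: "\<sigma> \<in> Typ n" "\<tau> \<in> Typ n" and eq: "blocks \<sigma> = blocks \<tau>"
  then have "mset (\<sigma> d) = mset (\<tau> d)"
    by (intro multiset_eqI) (metis (no_types, lifting) OTyp_def Typ_def count_blocks mem_Collect_eq)
  moreover have "sorted (rev (\<sigma> d))" "sorted (rev (\<tau> d))"
    using mem by (auto simp: Typ_def is_partition_def sorted_wrt_rev)
  ultimately show "\<sigma> d = \<tau> d"
    by (metis mset_rev properties_for_sort rev_rev_ident)
qed

section \<open>Linear independence of the products indexed by types\<close>

lemma independent_e_otimes: "mps.independent (e_otimes ` Typ n)"
  and inj_on_e_otimes: "inj_on e_otimes (Typ n)"
proof -
  have lead: "has_lead (lead_blocks (blocks \<tau>)) (e_otimes \<tau>)" for \<tau>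
    by (simp add: e_otimes_eq has_lead_e_blocks)
  have inj: "inj_on (lead_blocks \<circ> blocks) (Typ n)"
  proof (rule comp_inj_on [OF blocks_inj_on_Typ], rule inj_onI)
    fix M N assume "M \<in> blocks ` Typ n" "N \<in> blocks ` Typ n" "lead_blocks M = lead_blocks N"
    then show "M = N"
      by (intro lead_blocks_inj) (auto simp: Typ_def dest: OTyp_blocks_pos)
  qed
  show inj_e: "inj_on e_otimes (Typ n)"
  proof (rule inj_onI)
    fix \<sigma> \<tau> assume "\<sigma> \<in> Typ n" "\<tau> \<in> Typ n" "e_otimes \<sigma> = e_otimes \<tau>"
    then show "\<sigma> = \<tau>"
      using has_lead_unique lead inj_onD [OF inj, of \<sigma> \<tau>] by (metis comp_apply)
  qed
  show "mps.independent (e_otimes ` Typ n)"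
  proof (rule independent_if_distinct_leads)
    \<comment> \<open>The leading monomial has to be a function of the series, so the type is
      recovered by inverting \<open>e_otimes\<close>.\<close>
    let ?L = "\<lambda>f. lead_blocks (blocks (the_inv_into (Typ n) e_otimes f))"
    show "has_lead (?L f) f" if "f \<in> e_otimes ` Typ n" for f
      using that lead inj_e by (auto simp: the_inv_into_f_f)
    show "inj_on ?L (e_otimes ` Typ n)"
      using inj inj_e by (auto simp: inj_on_def the_inv_into_f_f)
  qed
qed


section \<open>Sums over polywrappings\<close>

text \<open>Collecting the blocks with the same first entry and sorting their second entries
  decreasingly yields the type. This supplies a type for the content of every tabloid.\<close>

lemma blocks_surj_Typ:
  assumes pos: "\<And>b. b \<in># M \<Longrightarrow> fst b \<ge> 1 \<and> snd b \<ge> 1" and deg: "(\<Sum>(i, k)\<in>#M. i * k) = n"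
  obtains \<tau> where "\<tau> \<in> Typ n" "blocks \<tau> = M"
proof
  define \<tau> where "\<tau> d = rev (sorted_list_of_multiset (image_mset snd (filter_mset (\<lambda>b. fst b = d) M)))" for d
  have mset: "mset (\<tau> d) = image_mset snd (filter_mset (\<lambda>b. fst b = d) M)" for d
    by (simp add: \<tau>_def)
  have "osupp \<tau> \<subseteq> fst ` set_mset M"
  proof
    fix d assume "d \<in> osupp \<tau>"
    then have "mset (\<tau> d) \<noteq> {#}" by (simp add: osupp_def)
    then show "d \<in> fst ` set_mset M" unfolding mset by (auto simp: filter_mset_eq_conv multiset_nonemptyE)
  qed
  then have fin: "finite (osupp \<tau>)" by (rule finite_subset) simp
  have "count (image_mset snd (filter_mset (\<lambda>b. fst b = d) M)) k = count M (d, k)" for d k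
    by (induction M) auto
  then have count: "count (mset (\<tau> d)) k = count M (d, k)" for d k
    by (simp only: mset)
  show M: "blocks \<tau> = M"
  proof (rule multiset_eqI)
    fix b show "count (blocks \<tau>) b = count M b"
      by (cases b) (simp only: count_blocks [OF fin] count)
  qed
  have set: "k \<in> set (\<tau> d) \<longleftrightarrow> (d, k) \<in># M" for d k
    using count [of d k] by (simp flip: count_greater_zero_iff set_mset_mset)
  have comp: "is_composition (\<tau> d)" for d
    using pos by (fastforce simp: is_composition_def set)
  have nil: "\<tau> 0 = []"
    using pos [of "(0, _)"] set [of _ 0] by (cases "\<tau> 0") force+
  have "sorted_wrt (\<ge>) (\<tau> d)" for d
    by (simp add: \<tau>_def sorted_wrt_rev)
  then show "\<tau> \<in> Typ n"
    using comp nil fin deg sum_mset_blocks [of "\<lambda>i. i" \<tau>]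
    by (simp add: Typ_def OTyp_def is_partition_def M)
qed

section \<open>Block series as sums over bounded polywrappings\<close>

definition bounded_polywrappings :: "nat \<times> nat \<Rightarrow> polywrapping set" where
  "bounded_polywrappings b = {D \<in> polywrappings b. r_bounded (snd b) D}"

definition pblocks :: "nat \<times> nat \<Rightarrow> polywrapping \<Rightarrow> (nat \<times> nat) multiset" where
  "pblocks b D = blocks (psort (pocon b D))"

lemma pocon_in_OTyp: "D \<in> polywrappings (d, r) \<Longrightarrow> pocon (d, r) D \<in> OTyp (d * r)"
  by (auto simp: polywrappings_def pocon_polywrapping_of) (simp add: OTyp_r_def)

text \<open>Ordered types that are not r-bounded drop out because their \<open>shat\<close> is 0; on
  the others \<open>polywrapping_of r\<close> and \<open>pocon b\<close> are mutually inverse.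
  Sorting keeps the blocks, so the area and \<open>e_otimes\<close> can be read off from
  \<open>pblocks\<close>.\<close>

lemma E_block_eq_polywrappings:
  assumes r: "snd b \<ge> 1"
  shows "E_block b = (\<Sum>D\<in>bounded_polywrappings b.
    of_int ((-1) ^ (\<Sum>(i, k)\<in>#pblocks b D. k) * psgn b D) * e_blocks (pblocks b D))"
proof -
  obtain d r where b: "b = (d, r)" by (cases b)
  let ?B = "{\<delta> \<in> OTyp_r r (d * r). \<forall>k. length (\<delta> k) \<le> r}"
  let ?t = "\<lambda>\<delta>. of_int ((-1) ^ area \<delta> * shat r \<delta>) * e_otimes \<delta>"
  have len: "length (polywrapping_of r \<delta> k) = length (\<delta> k)" for \<delta> k
    by (simp add: polywrapping_of_def wrapping_def)
  have "shat r \<delta> = 0" if \<delta>: "\<delta> \<in> OTyp_r r (d * r)" "\<delta> \<notin> ?B" for \<delta>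
  proof -
    obtain k where "\<not> length (\<delta> k) \<le> r" using \<delta> by auto
    moreover from this have "k \<in> osupp \<delta>" by (auto simp: osupp_def)
    moreover have "finite (osupp \<delta>)" using \<delta> by (simp add: OTyp_r_def OTyp_def)
    ultimately show ?thesis unfolding shat_def
      by (intro prod_zero) (auto simp: shat_comp_def)
  qed
  then have "\<forall>\<delta>\<in>OTyp_r r (d * r) - ?B. ?t \<delta> = 0" by simp
  moreover have "r \<ge> 1" using r by (simp add: b)
  ultimately have "E_block b = (\<Sum>\<delta>\<in>?B. ?t \<delta>)"
    unfolding b E_block_eq [OF \<open>r \<ge> 1\<close>]
    by (intro sum.mono_neutral_right finite_OTyp_r) blast+
  also have "\<dots> = (\<Sum>D\<in>bounded_polywrappings b.
      of_int ((-1) ^ (\<Sum>(i, k)\<in>#pblocks b D. k) * psgn b D) * e_blocks (pblocks b D))"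
  proof (rule sum.reindex_bij_witness [where i = "pocon b" and j = "polywrapping_of r"])
    fix \<delta> assume \<delta>: "\<delta> \<in> ?B"
    then have po: "pocon b (polywrapping_of r \<delta>) = \<delta>"
      by (simp add: b pocon_polywrapping_of)
    then show "pocon b (polywrapping_of r \<delta>) = \<delta>" .
    show "polywrapping_of r \<delta> \<in> bounded_polywrappings b"
      using \<delta> by (auto simp: b bounded_polywrappings_def polywrappings_def r_bounded_def len)
    show "of_int ((-1) ^ (\<Sum>(i, k)\<in>#pblocks b (polywrapping_of r \<delta>). k) * psgn b (polywrapping_of r \<delta>)) *
        e_blocks (pblocks b (polywrapping_of r \<delta>)) = ?t \<delta>"
      by (simp add: pblocks_def po blocks_psort area_eq_sum_blocks e_otimes_eq psgn_def b po [unfolded b])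
  next
    fix D assume "D \<in> bounded_polywrappings b"
    then obtain \<delta> where "\<delta> \<in> OTyp_r r (d * r)" "D = polywrapping_of r \<delta>" "\<forall>k. length (\<delta> k) \<le> r"
      by (auto simp: b bounded_polywrappings_def polywrappings_def r_bounded_def len)
    then show "polywrapping_of r (pocon b D) = D" "pocon b D \<in> ?B"
      by (simp_all add: b pocon_polywrapping_of)
  qed
  finally show ?thesis .
qed

lemma finite_bounded_polywrappings:
  "snd b \<ge> 1 \<Longrightarrow> finite (bounded_polywrappings b)"
  unfolding bounded_polywrappings_def polywrappings_def
  by (auto simp: case_prod_unfold finite_OTyp_r)

section \<open>Multiplying out the block series\<close>

lemma finite_list_all2:
  assumes "\<And>x. x \<in> set xs \<Longrightarrow> finite (B x)"
  shows "finite {ys. list_all2 (\<lambda>x y. y \<in> B x) xs ys}"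
  using assms
proof (induction xs)
  case (Cons x xs)
  have "{ys. list_all2 (\<lambda>x y. y \<in> B x) (x # xs) ys} =
      (\<lambda>(y, ys). y # ys) ` (B x \<times> {ys. list_all2 (\<lambda>x y. y \<in> B x) xs ys})"
    by (auto simp: list_all2_Cons1)
  with Cons show ?case by simp
next
  case Nil
  have "{ys. list_all2 (\<lambda>x y. y \<in> B x) [] ys} \<subseteq> {[]}" by auto
  then show ?case by (rule finite_subset) simp
qed

lemma prod_list_sum:
  fixes f :: "'a \<Rightarrow> 'b \<Rightarrow> 'c::comm_ring_1"
  shows "(\<Prod>x\<leftarrow>xs. \<Sum>y\<in>B x. f x y) =
    (\<Sum>ys | list_all2 (\<lambda>x y. y \<in> B x) xs ys. \<Prod>(x, y)\<leftarrow>zip xs ys. f x y)"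
proof (induction xs)
  case (Cons x xs)
  let ?S = "{ys. list_all2 (\<lambda>x y. y \<in> B x) xs ys}"
  have "{ys. list_all2 (\<lambda>x y. y \<in> B x) (x # xs) ys} = (\<lambda>(y, ys). y # ys) ` (B x \<times> ?S)"
    by (auto simp: list_all2_Cons1)
  moreover have "inj_on (\<lambda>(y, ys). y # ys) (B x \<times> ?S)"
    by (auto simp: inj_on_def)
  ultimately have "(\<Sum>ys | list_all2 (\<lambda>x y. y \<in> B x) (x # xs) ys. \<Prod>(x, y)\<leftarrow>zip (x # xs) ys. f x y) =
      (\<Sum>(y, ys)\<in>B x \<times> ?S. f x y * (\<Prod>(x, y)\<leftarrow>zip xs ys. f x y))"
    by (simp add: sum.reindex case_prod_unfold)
  also have "\<dots> = (\<Sum>y\<in>B x. f x y) * (\<Sum>ys\<in>?S. \<Prod>(x, y)\<leftarrow>zip xs ys. f x y)"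
    by (simp add: sum_product sum.cartesian_product)
  finally show ?case using Cons.IH by simp
qed simp

lemma of_int_mult_mpseries: "of_int c * f = mscale (of_int c) f" for f :: "'v mpseries"
proof -
  have *: "of_nat k * f = mscale (of_nat k) f" for k
    by (induction k) (simp_all add: algebra_simps mps.scale_left_distrib)
  show ?thesis
    by (cases c rule: int_cases2) (simp_all add: *)
qed

text \<open>Areas add and signs multiply, so the product over the blocks of a tabloid becomes a
  single term in its total content.\<close>

lemma prod_list_terms:
  "(\<Prod>(b, D)\<leftarrow>zs. of_int ((-1) ^ (\<Sum>(i, k)\<in>#M b D. k) * s b D) * e_blocks (M b D)) =
   of_int ((-1) ^ (\<Sum>(i, k)\<in>#(\<Sum>(b, D)\<leftarrow>zs. M b D). k) * (\<Prod>(b, D)\<leftarrow>zs. s b D)) *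
     e_blocks (\<Sum>(b, D)\<leftarrow>zs. M b D)"
proof (induction zs)
  case (Cons z zs)
  then show ?case
    by (simp add: case_prod_unfold e_blocks_def power_add mult_ac)
qed (simp add: e_blocks_def)

theorem theorem64:
  fixes n :: nat and \<sigma> \<tau> :: otype and bs :: "(nat \<times> nat) list"
  assumes "\<sigma> \<in> Typ n" and "\<tau> \<in> Typ n"
    and "mset bs = blocks \<sigma>"
  shows "e_otimes_coeff n (E_type \<sigma>) \<tau> =
           (-1) ^ area \<tau> * of_int (\<Sum>T\<in>tabloids bs \<tau>. psgn_tabloid bs T)"
proof -
  \<comment> \<open>All bounded tabloids of the given shape, with the content left free.\<close>
  let ?\<T> = "{T. list_all2 (\<lambda>b D. D \<in> bounded_polywrappings b) bs T}"
  define M where "M T = (\<Sum>(b, D)\<leftarrow>zip bs T. pblocks b D)" for T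
  define c where "c T = (-1) ^ (\<Sum>(i, k)\<in>#M T. k) * psgn_tabloid bs T" for T
  have bs: "fst b \<ge> 1 \<and> snd b \<ge> 1" if "b \<in> set bs" for b
  proof (rule OTyp_blocks_pos)
    show "\<sigma> \<in> OTyp n" using assms(1) by (simp add: Typ_def)
    show "b \<in># blocks \<sigma>" using that assms(3) by (metis set_mset_mset)
  qed
  have fin: "finite ?\<T>"
    using bs by (intro finite_list_all2 finite_bounded_polywrappings) blast
  \<comment> \<open>A polywrapping of d^r has content of degree d r, so the blocks of a tabloid have
    total degree n and form a type of n.\<close>
  have "\<exists>\<rho>. \<rho> \<in> Typ n \<and> blocks \<rho> = M T" if T: "T \<in> ?\<T>" for T
  proof -
    have D: "pocon b D \<in> OTyp (fst b * snd b)" if "(b, D) \<in> set (zip bs T)" for b D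
    proof -
      have "D \<in> bounded_polywrappings b"
        using T that by (auto simp: list_all2_iff)
      then show ?thesis
        using pocon_in_OTyp [of D "fst b" "snd b"] by (simp add: bounded_polywrappings_def)
    qed
    show ?thesis
    proof (rule blocks_surj_Typ [of "M T" n])
      fix x assume "x \<in># M T"
      moreover have "x \<in># (\<Sum>(b, D)\<leftarrow>zs. pblocks b D) \<longleftrightarrow> (\<exists>(b, D)\<in>set zs. x \<in># pblocks b D)" for zs
        by (induction zs) auto
      ultimately obtain b D where "(b, D) \<in> set (zip bs T)" "x \<in># pblocks b D"
        unfolding M_def by blast
      then show "fst x \<ge> 1 \<and> snd x \<ge> 1"
        using OTyp_blocks_pos [OF D] unfolding pblocks_def blocks_psort by blast
    next
      have "(\<Sum>(i, k)\<in>#M T. i * k) = (\<Sum>(b, D)\<leftarrow>zip bs T. \<Sum>(i, k)\<in>#pblocks b D. i * k)"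
      proof -
        have "(\<Sum>(i, k)\<in>#(\<Sum>(b, D)\<leftarrow>zs. pblocks b D). i * k) = (\<Sum>(b, D)\<leftarrow>zs. \<Sum>(i, k)\<in>#pblocks b D. i * k)" for zs
          by (induction zs) auto
        then show ?thesis by (simp add: M_def)
      qed
      also have "\<dots> = (\<Sum>(b, D)\<leftarrow>zip bs T. fst b * snd b)"
        using OTyp_blocks_degree [OF D]
        by (intro arg_cong [where f = sum_list] map_cong) (auto simp: pblocks_def blocks_psort)
      also have "\<dots> = (\<Sum>b\<leftarrow>map fst (zip bs T). fst b * snd b)"
        by (simp add: comp_def case_prod_unfold)
      also have "map fst (zip bs T) = bs"
        using T by (simp add: list_all2_lengthD)
      also have "(\<Sum>b\<leftarrow>bs. fst b * snd b) = (\<Sum>(i, k)\<in>#blocks \<sigma>. i * k)"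
        unfolding assms(3) [symmetric] by (simp add: case_prod_unfold sum_mset_sum_list [symmetric])
      also have "\<dots> = n" using assms(1) by (auto simp: Typ_def intro: OTyp_blocks_degree)
      finally show "(\<Sum>(i, k)\<in>#M T. i * k) = n" .
    qed blast
  qed
  then obtain \<rho> where \<rho>: "\<And>T. T \<in> ?\<T> \<Longrightarrow> \<rho> T \<in> Typ n \<and> blocks (\<rho> T) = M T" by metis
  have "E_type \<sigma> = (\<Prod>b\<leftarrow>bs. E_block b)"
    unfolding E_type_def assms(3) [symmetric] by (simp add: prod_mset_prod_list [symmetric])
  also have "\<dots> = (\<Prod>b\<leftarrow>bs. \<Sum>D\<in>bounded_polywrappings b.
      of_int ((-1) ^ (\<Sum>(i, k)\<in>#pblocks b D. k) * psgn b D) * e_blocks (pblocks b D))"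
    using bs by (intro arg_cong [where f = prod_list] map_cong refl E_block_eq_polywrappings) blast
  also have "\<dots> = (\<Sum>T\<in>?\<T>. of_int (c T) * e_blocks (M T))"
    unfolding prod_list_sum prod_list_terms c_def M_def psgn_tabloid_def ..
  also have "\<dots> = (\<Sum>T\<in>?\<T>. mscale (of_int (c T)) (e_otimes (\<rho> T)))"
    by (intro sum.cong refl) (simp add: \<rho> of_int_mult_mpseries e_otimes_eq)
  finally have E: "E_type \<sigma> = (\<Sum>T\<in>?\<T>. mscale (of_int (c T)) (e_otimes (\<rho> T)))" .
  note ind = independent_e_otimes [of n]
  have span: "e_otimes (\<rho> T) \<in> mps.span (e_otimes ` Typ n)" if "T \<in> ?\<T>" for T
    using \<rho> [OF that] by (auto intro: mps.span_base)
  have "e_otimes_coeff n (E_type \<sigma>) \<tau> =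
      (\<Sum>T\<in>?\<T>. of_int (c T) * mps.representation (e_otimes ` Typ n) (e_otimes (\<rho> T)) (e_otimes \<tau>))"
  proof -
    have "mps.representation (e_otimes ` Typ n) (\<Sum>T\<in>?\<T>. mscale (of_int (c T)) (e_otimes (\<rho> T))) =
        (\<lambda>f. \<Sum>T\<in>?\<T>. mps.representation (e_otimes ` Typ n) (mscale (of_int (c T)) (e_otimes (\<rho> T))) f)"
      by (rule mps.representation_sum [OF ind]) (use span in \<open>blast intro: mps.span_scale\<close>)
    then have "e_otimes_coeff n (E_type \<sigma>) \<tau> = (\<Sum>T\<in>?\<T>.
        mps.representation (e_otimes ` Typ n) (mscale (of_int (c T)) (e_otimes (\<rho> T))) (e_otimes \<tau>))"
      unfolding e_otimes_coeff_def E by (rule fun_cong)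
    also have "\<dots> = (\<Sum>T\<in>?\<T>.
        of_int (c T) * mps.representation (e_otimes ` Typ n) (e_otimes (\<rho> T)) (e_otimes \<tau>))"
      by (intro sum.cong refl) (simp only: mps.representation_scale [OF ind span])
    finally show ?thesis .
  qed
  also have "\<dots> = (\<Sum>T\<in>?\<T>. if M T = blocks \<tau> then of_int (c T) else 0)"
  proof (intro sum.cong refl)
    fix T assume "T \<in> ?\<T>"
    note \<rho>T = \<rho> [OF this]
    \<comment> \<open>The coordinates of a basis vector are 0 or 1. Since \<open>e_otimes\<close>
      and \<open>blocks\<close> are both injective on types, the coordinate tests whether the
      content is \<tau>.\<close>
    have "e_otimes \<tau> = e_otimes (\<rho> T) \<longleftrightarrow> \<tau> = \<rho> T"
      using \<rho>T assms(2) inj_on_eq_iff [OF inj_on_e_otimes] by blast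
    also have "\<dots> \<longleftrightarrow> blocks \<tau> = M T"
      using \<rho>T assms(2) inj_on_eq_iff [OF blocks_inj_on_Typ] by metis
    finally show "of_int (c T) * mps.representation (e_otimes ` Typ n) (e_otimes (\<rho> T)) (e_otimes \<tau>) =
        (if M T = blocks \<tau> then of_int (c T) else 0)"
      using \<rho>T by (simp add: mps.representation_basis [OF ind])
  qed
  also have "\<dots> = (\<Sum>T\<in>{T \<in> ?\<T>. M T = blocks \<tau>}. of_int (c T))"
    by (rule sum.inter_filter [OF fin, symmetric])
  also have "{T \<in> ?\<T>. M T = blocks \<tau>} = tabloids bs \<tau>"
    by (simp add: tabloids_def bounded_polywrappings_def M_def pblocks_def)
  \<comment> \<open>For content \<tau> the sign is constant, because the parts of the total content
    add up to \<open>area \<tau>\<close>.\<close>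
  also have "(\<Sum>T\<in>tabloids bs \<tau>. of_int (c T)) =
      (\<Sum>T\<in>tabloids bs \<tau>. (-1) ^ area \<tau> * of_int (psgn_tabloid bs T))"
    by (intro sum.cong refl)
       (simp add: c_def area_eq_sum_blocks M_def pblocks_def tabloids_def)
  finally show ?thesis by (simp add: sum_distrib_left)
qed

end
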